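(* Consider the equation $$\lambda_{xxxy}-\lambda_{xyyy}=\varepsilon\,\mathcal{Q}(\lambda,\lambda),$$ where for functions $u,v$ of $(x,y)$ $$\mathcal{Q}(u,v)=u_{xy}(v_{yyyy}-v_{xxxx})+3(u_{yyy}v_{xyy}-u_{xxx}v_{xxy})+2(u_{yy}v_{xyyy}-u_{xx}v_{xxxy}),$$ and look for a formal solution $\lambda=\sum_{k\ge0}\lambda_k\varepsilon^k$, i.e. $(\lambda_k)_{xxxy}-(\lambda_k)_{xyyy}=\sum_{p+q=k-1,\ p,q\ge0}\mathcal{Q}(\lambda_p,\lambda_q)$ for $k\ge1$. Let $$\lambda_0=\sum_{m\ge1}\alpha_m(\cos mx+\cos my)+\sum_{m\ge1}\beta_m(\cos m(x-y)+\cos m(x+y)),$$ and for each $k\ge1$ let $\tilde\lambda_k=\sum_{m\ge1}\alpha^k_m(\cos mx+\cos my)+\sum_{m\ge1}\beta^k_m(\cos m(x-y)+\cos m(x+y))$, where all coefficient sequences are real and decay faster than any power of $m$. Then one can inductively define, for every $k\ge1$, a smooth $2\pi\mathbb{Z}^2$-periodic function $\lambda_k$ solving the $k$-th recursion equation, namely $\lambda_k=\mu_k+\tilde\lambda_k$ where $\mu_k$ is the unique smooth periodic solution whose Fourier coefficients at all modes $e^{i(mx+ny)}$ with $mn(m^2-n^2)=0$ vanish: at each step the right-hand side $\sum_{p+q=k-1}\mathcal{Q}(\lambda_p,\lambda_q)$ is a smooth periodic function with vanishing Fourier coefficients at all modes $e^{imx},e^{imy},e^{im(x+y)},e^{im(x-y)}$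 ($m\in\mathbb{Z}$), and every $\lambda_k$ is invariant under $(x,y)\mapsto(-x,y)$, $(x,y)\mapsto(x,-y)$ and $(x,y)\mapsto(y,x)$.
   Context: This equation is the equation $\lambda_{xy}(\lambda_{yyyy}-\lambda_{xxxx})+3(\lambda_{yyy}\lambda_{xyy}-\lambda_{xxy}\lambda_{xxx})+2(\lambda_{yy}\lambda_{xyyy}-\lambda_{xx}\lambda_{xxxy})+4a_{22}\lambda_{xyyy}-4a_{11}\lambda_{xxxy}+2a_{12}(\lambda_{yyyy}-\lambda_{xxxx})=0$ for $a_{12}=0$, $a_{11}=a_{22}=\frac{1}{4\varepsilon}$, multiplied by $\varepsilon$. Periodicity refers to the lattice $2\pi\mathbb{Z}^2$ (the paper writes the integer lattice with period $2\pi$ in trigonometric form). The operator $\partial_x\partial_y(\partial_x^2-\partial_y^2)$ acts on $e^{i(mx+ny)}$ by multiplication by $mn(m^2-n^2)$. *)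

theory Defs
  imports "HOL-Analysis.Analysis"
begin

definition dx :: "(real \<Rightarrow> real \<Rightarrow> real) \<Rightarrow> real \<Rightarrow> real \<Rightarrow> real" where
  "dx f = (\<lambda>x y. deriv (\<lambda>t. f t y) x)"

definition dy :: "(real \<Rightarrow> real \<Rightarrow> real) \<Rightarrow> real \<Rightarrow> real \<Rightarrow> real" where
  "dy f = (\<lambda>x y. deriv (\<lambda>t. f x t) y)"

fun pd :: "bool list \<Rightarrow> (real \<Rightarrow> real \<Rightarrow> real) \<Rightarrow> real \<Rightarrow> real \<Rightarrow> real" where
  "pd [] f = f"
| "pd (b # bs) f = (if b then dx else dy) (pd bs f)"

definition smooth2 :: "(real \<Rightarrow> real \<Rightarrow> real) \<Rightarrow> bool" where
  "smooth2 f \<longleftrightarrow> (\<forall>ws. continuous_on UNIV (\<lambda>z::real\<times>real. pd ws f (fst z) (snd z)) \<and>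
      (\<forall>x y. (\<lambda>t. pd ws f t y) differentiable (at x) \<and> (\<lambda>t. pd ws f x t) differentiable (at y)))"

definition periodic2 :: "(real \<Rightarrow> real \<Rightarrow> real) \<Rightarrow> bool" where
  "periodic2 f \<longleftrightarrow> (\<forall>x y. f (x + 2*pi) y = f x y \<and> f x (y + 2*pi) = f x y)"

definition smooth_periodic :: "(real \<Rightarrow> real \<Rightarrow> real) \<Rightarrow> bool" where
  "smooth_periodic f \<longleftrightarrow> smooth2 f \<and> periodic2 f"

definition fcoeff :: "(real \<Rightarrow> real \<Rightarrow> real) \<Rightarrow> int \<Rightarrow> int \<Rightarrow> complex" where
  "fcoeff f m n = integral (cbox (0,0) (2*pi, 2*pi))
      (\<lambda>z::real\<times>real. complex_of_real (f (fst z) (snd z)) *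
          exp (- \<i> * complex_of_real (of_int m * fst z + of_int n * snd z))) / (4 * pi\<^sup>2)"

definition Qop :: "(real \<Rightarrow> real \<Rightarrow> real) \<Rightarrow> (real \<Rightarrow> real \<Rightarrow> real) \<Rightarrow> real \<Rightarrow> real \<Rightarrow> real" where
  "Qop u v = (\<lambda>x y.
      pd [True, False] u x y * (pd [False, False, False, False] v x y - pd [True, True, True, True] v x y)
    + 3 * (pd [False, False, False] u x y * pd [True, False, False] v x y
           - pd [True, True, True] u x y * pd [True, True, False] v x y)
    + 2 * (pd [False, False] u x y * pd [True, False, False, False] v x y
           - pd [True, True] u x y * pd [True, True, True, False] v x y))"

definition Lop :: "(real \<Rightarrow> real \<Rightarrow> real) \<Rightarrow> real \<Rightarrow> real \<Rightarrow> real" where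
  "Lop f = (\<lambda>x y. pd [True, True, True, False] f x y - pd [True, False, False, False] f x y)"

definition rhs :: "(nat \<Rightarrow> real \<Rightarrow> real \<Rightarrow> real) \<Rightarrow> nat \<Rightarrow> real \<Rightarrow> real \<Rightarrow> real" where
  "rhs lam k = (\<lambda>x y. \<Sum>p<k. Qop (lam p) (lam (k - 1 - p)) x y)"

definition rapid :: "(nat \<Rightarrow> real) \<Rightarrow> bool" where
  "rapid a \<longleftrightarrow> (\<forall>N::nat. \<exists>C. \<forall>m\<ge>1. \<bar>a m\<bar> * real m ^ N \<le> C)"

definition cos_series :: "(nat \<Rightarrow> real) \<Rightarrow> (nat \<Rightarrow> real) \<Rightarrow> real \<Rightarrow> real \<Rightarrow> real" where
  "cos_series a b = (\<lambda>x y.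
      (\<Sum>m. a (Suc m) * (cos (real (Suc m) * x) + cos (real (Suc m) * y)))
    + (\<Sum>m. b (Suc m) * (cos (real (Suc m) * (x - y)) + cos (real (Suc m) * (x + y)))))"

definition resonant :: "int \<Rightarrow> int \<Rightarrow> bool" where
  "resonant m n \<longleftrightarrow> m * n * (m\<^sup>2 - n\<^sup>2) = 0"

end

theory Submission
  imports Defs
begin

text \<open>The vanishing of the resonant coefficients is a matter of symmetry alone: if \<open>u\<close> and \<open>v\<close> are
  even in each variable and symmetric in \<open>(x, y)\<close>, then \<open>Q(u, v)\<close> is odd in each variable and
  antisymmetric under the swap, which kills all modes \<open>(m, 0)\<close>, \<open>(0, m)\<close>, \<open>(m, m)\<close>, \<open>(m, -m)\<close>.
  Since the operator on the left factors as the product of the four directional derivatives along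
  \<open>(1, 0)\<close>, \<open>(0, 1)\<close>, \<open>(1, 1)\<close>, \<open>(1, -1)\<close>, it is inverted on the non-resonant modes by four
  successive averages along closed lines against a sawtooth kernel. Such averages visibly preserve
  smoothness and periodicity, so no Fourier series has to be summed; all identities between smooth
  periodic functions follow by comparing Fourier coefficients, using completeness of the characters
  (Stone-Weierstrass on the torus).\<close>

subsection \<open>Calculus of smooth periodic functions\<close>

abbreviation cont2 :: "(real \<Rightarrow> real \<Rightarrow> 'a::topological_space) \<Rightarrow> bool" where
  "cont2 f \<equiv> continuous_on UNIV (\<lambda>z::real\<times>real. f (fst z) (snd z))"

lemma cont2_compose:
  assumes "cont2 f" "continuous_on S u" "continuous_on S v"
  shows "continuous_on S (\<lambda>t. f (u t) (v t))"
  using continuous_on_compose2[OF assms(1) continuous_on_Pair[OF assms(2,3)]] by simp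

text \<open>A relational form of the partials: \<open>deriv\<close> is total and returns a value
  even where no derivative exists, so differentiability has to travel together with the
  values.\<close>

definition has_partials where
  "has_partials f g h \<longleftrightarrow> (\<forall>x y. ((\<lambda>t. f t y) has_real_derivative g x y) (at x) \<and>
     ((\<lambda>t. f x t) has_real_derivative h x y) (at y))"

lemma has_partials_dx: "has_partials f g h \<Longrightarrow> dx f = g"
  by (auto simp: has_partials_def dx_def fun_eq_iff intro!: DERIV_imp_deriv)

lemma has_partials_dy: "has_partials f g h \<Longrightarrow> dy f = h"
  by (auto simp: has_partials_def dy_def fun_eq_iff intro!: DERIV_imp_deriv)

text \<open>Smoothness speaks about every word of derivatives. A class of continuous periodic
  functions that is stable under taking partials contains all iterated partials of its members, by
  induction on the word.\<close>

lemma smooth_periodic_coinduct: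
  assumes "P f"
    and step: "\<And>f. P f \<Longrightarrow> periodic2 f \<and> cont2 f \<and> (\<exists>g h. P g \<and> P h \<and> has_partials f g h)"
  shows "smooth_periodic f"
proof -
  have "P (pd ws f)" for ws
  proof (induction ws)
    case (Cons b ws)
    then obtain g h where "P g" "P h" "has_partials (pd ws f) g h" using step by blast
    then show ?case by (simp add: has_partials_dx has_partials_dy)
  qed (use assms in simp)
  then have "cont2 (pd ws f) \<and> (\<exists>g h. has_partials (pd ws f) g h)" for ws
    using step by blast
  then have "smooth2 f"
    unfolding smooth2_def has_partials_def real_differentiable_def by blast
  then show ?thesis
    unfolding smooth_periodic_def using step assms by blast
qed

lemma pd_append: "pd (ws @ vs) f = pd ws (pd vs f)"
  by (induction ws) auto

lemma smooth2_pd: "smooth2 f \<Longrightarrow> smooth2 (pd vs f)"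
  unfolding smooth2_def by (metis pd_append)

lemma smooth_periodic_cont2: "smooth_periodic f \<Longrightarrow> cont2 f"
  unfolding smooth_periodic_def smooth2_def by (metis pd.simps(1))

lemma smooth_periodic_periodic: "smooth_periodic f \<Longrightarrow> periodic2 f"
  unfolding smooth_periodic_def by blast

lemma smooth_periodic_has_partials:
  assumes "smooth_periodic f" shows "has_partials f (dx f) (dy f)"
proof -
  have "(\<lambda>t. f t y) differentiable (at x)" "(\<lambda>t. f x t) differentiable (at y)" for x y
    using assms unfolding smooth_periodic_def smooth2_def by (metis pd.simps(1))+
  then show ?thesis
    unfolding has_partials_def dx_def dy_def
    by (simp add: DERIV_deriv_iff_real_differentiable)
qed

text \<open>Translating \<open>f\<close> by a period changes nothing, so uniqueness of derivatives
  carries the period over to \<open>g\<close> and \<open>h\<close>.\<close>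

lemma periodic2_partials:
  assumes "has_partials f g h" "periodic2 f"
  shows "periodic2 g" "periodic2 h"
proof -
  have per: "\<And>x y. f (x + 2*pi) y = f x y" "\<And>x y. f x (y + 2*pi) = f x y"
    using assms(2) by (auto simp: periodic2_def)
  have gd: "\<And>x y. ((\<lambda>t. f t y) has_real_derivative g x y) (at x)"
    and hd: "\<And>x y. ((\<lambda>t. f x t) has_real_derivative h x y) (at y)"
    using assms(1) by (auto simp: has_partials_def)
  show "periodic2 g"
    unfolding periodic2_def
  proof (intro allI conjI)
    fix x y
    have "((\<lambda>t. f t y) has_real_derivative g (x + 2*pi) y) (at x)"
      using gd[of y "x + 2*pi"] by (simp add: DERIV_shift per)
    then show "g (x + 2*pi) y = g x y" using gd DERIV_unique by blast
    show "g x (y + 2*pi) = g x y" using gd[of "y + 2*pi" x] gd[of y x] DERIV_unique by (simp add: per)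
  qed
  show "periodic2 h"
    unfolding periodic2_def
  proof (intro allI conjI)
    fix x y
    have "((\<lambda>t. f x t) has_real_derivative h x (y + 2*pi)) (at y)"
      using hd[of x "y + 2*pi"] by (simp add: DERIV_shift per)
    then show "h x (y + 2*pi) = h x y" using hd DERIV_unique by blast
    show "h (x + 2*pi) y = h x y" using hd[of "x + 2*pi" y] hd[of x y] DERIV_unique by (simp add: per)
  qed
qed

lemma smooth_periodic_dx: "smooth_periodic f \<Longrightarrow> smooth_periodic (dx f)"
  using smooth2_pd[of f "[True]"] periodic2_partials(1)[OF smooth_periodic_has_partials]
  by (simp add: smooth_periodic_def)

lemma smooth_periodic_dy: "smooth_periodic f \<Longrightarrow> smooth_periodic (dy f)"
  using smooth2_pd[of f "[False]"] periodic2_partials(2)[OF smooth_periodic_has_partials]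
  by (simp add: smooth_periodic_def)

lemma smooth_periodic_pd: "smooth_periodic f \<Longrightarrow> smooth_periodic (pd ws f)"
  by (induction ws) (auto simp: smooth_periodic_dx smooth_periodic_dy)

lemma periodic2_of_int:
  assumes "periodic2 f"
  shows "f (x + 2*pi * of_int k) (y + 2*pi * of_int l) = f x y"
proof -
  have 1: "f (x + 2*pi * of_int k) y = f x y" for x y k
  proof (induction k rule: int_induct[of _ 0])
    case (step1 i)
    then show ?case using assms unfolding periodic2_def
      by (metis (no_types, opaque_lifting) add.assoc distrib_left mult.right_neutral of_int_1 of_int_add)
  next
    case (step2 i)
    have "f (x + 2*pi * of_int (i - 1)) y = f (x + 2*pi * of_int (i - 1) + 2*pi) y"
      using assms unfolding periodic2_def by metis
    also have "\<dots> = f (x + 2*pi * of_int i) y" by (simp add: algebra_simps)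
    finally show ?case using step2 by simp
  qed simp
  have 2: "f x (y + 2*pi * of_int k) = f x y" for x y k
  proof (induction k rule: int_induct[of _ 0])
    case (step1 i)
    then show ?case using assms unfolding periodic2_def
      by (metis (no_types, opaque_lifting) add.assoc distrib_left mult.right_neutral of_int_1 of_int_add)
  next
    case (step2 i)
    have "f x (y + 2*pi * of_int (i - 1)) = f x (y + 2*pi * of_int (i - 1) + 2*pi)"
      using assms unfolding periodic2_def by metis
    also have "\<dots> = f x (y + 2*pi * of_int i)" by (simp add: algebra_simps)
    finally show ?case using step2 by simp
  qed simp
  show ?thesis by (simp add: 1 2)
qed

text \<open>On the mode $(m,n)$ this operator acts as division by $i(mp+nq)$ if $mp+nq \neq 0$, and as zero
  otherwise: it is the pseudo-inverse of the derivative in the direction $(p,q)$.\<close>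

definition line_op :: "int \<Rightarrow> int \<Rightarrow> (real \<Rightarrow> real \<Rightarrow> real) \<Rightarrow> real \<Rightarrow> real \<Rightarrow> real" where
  "line_op p q f = (\<lambda>x y. integral {0..2*pi} (\<lambda>s. (s - pi) / (2*pi) * f (x + s * of_int p) (y + s * of_int q)))"

text \<open>All operations are closed off at once because partials mix them: the product rule leaves
  products for sums, and reflection brings in a constant factor. Stability under partials is then
  one induction, and smoothness of every member follows.\<close>

inductive sp_closure :: "(real \<Rightarrow> real \<Rightarrow> real) \<Rightarrow> bool" where
  base: "smooth_periodic f \<Longrightarrow> sp_closure f"
| const: "sp_closure (\<lambda>x y. c)"
| add: "sp_closure f \<Longrightarrow> sp_closure g \<Longrightarrow> sp_closure (\<lambda>x y. f x y + g x y)"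
| mult: "sp_closure f \<Longrightarrow> sp_closure g \<Longrightarrow> sp_closure (\<lambda>x y. f x y * g x y)"
| flip: "sp_closure f \<Longrightarrow> sp_closure (\<lambda>x y. f (- x) y)"
| swap: "sp_closure f \<Longrightarrow> sp_closure (\<lambda>x y. f y x)"
| line: "sp_closure f \<Longrightarrow> sp_closure (line_op p q f)"

lemma cont2_flip: "cont2 f \<Longrightarrow> cont2 (\<lambda>x y. f (- x) y)"
  using cont2_compose[of f UNIV "\<lambda>z. - fst z" "\<lambda>z. snd z"]
  by (simp add: continuous_on_minus continuous_on_fst continuous_on_snd)

lemma cont2_swap: "cont2 f \<Longrightarrow> cont2 (\<lambda>x y. f y x)"
  using cont2_compose[of f UNIV "\<lambda>z. snd z" "\<lambda>z. fst z"]
  by (simp add: continuous_on_fst continuous_on_snd)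

lemma cont2_line_op:
  assumes "cont2 f" shows "cont2 (line_op p q f)"
proof -
  have "continuous_on (UNIV \<times> cbox 0 (2*pi)) (\<lambda>(z::real\<times>real,s). (s - pi) / (2*pi) * f (fst z + s * of_int p) (snd z + s * of_int q))"
    unfolding case_prod_unfold
    by (intro continuous_intros cont2_compose[OF assms]) auto
  from integral_continuous_on_param[OF this] show ?thesis
    by (simp add: line_op_def)
qed

text \<open>Differentiation under the integral sign; the sawtooth weight depends only on the
  integration variable.\<close>

lemma has_partials_line_op:
  assumes "has_partials f g h" "cont2 f" "cont2 g" "cont2 h"
  shows "has_partials (line_op p q f) (line_op p q g) (line_op p q h)"
proof -
  have gd: "\<And>x y. ((\<lambda>t. f t y) has_real_derivative g x y) (at x)"
    and hd: "\<And>x y. ((\<lambda>t. f x t) has_real_derivative h x y) (at y)"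
    using assms(1) by (auto simp: has_partials_def)
  have int: "(\<lambda>s. (s - pi) / (2*pi) * f (x + s * of_int p) (y + s * of_int q)) integrable_on cbox 0 (2*pi)" for x y
    by (intro integrable_continuous continuous_intros cont2_compose[OF assms(2)]) auto
  have 1: "((\<lambda>t. integral (cbox 0 (2*pi)) (\<lambda>s. (s - pi) / (2*pi) * f (t + s * of_int p) (y + s * of_int q)))
       has_real_derivative integral (cbox 0 (2*pi)) (\<lambda>s. (s - pi) / (2*pi) * g (x + s * of_int p) (y + s * of_int q)))
       (at x within UNIV)" for x y
  proof (rule leibniz_rule_field_derivative)
    show "continuous_on (UNIV \<times> cbox 0 (2 * pi)) (\<lambda>(t, s). (s - pi) / (2 * pi) * g (t + s * of_int p) (y + s * of_int q))"
      unfolding case_prod_unfold by (intro continuous_intros cont2_compose[OF assms(3)]) auto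
    show "((\<lambda>t. (s - pi) / (2 * pi) * f (t + s * of_int p) (y + s * of_int q)) has_real_derivative
            (s - pi) / (2 * pi) * g (t + s * of_int p) (y + s * of_int q)) (at t within UNIV)" for t s
      by (intro DERIV_cmult) (use gd[of "y + s * of_int q" "t + s * of_int p"] in \<open>simp add: DERIV_shift\<close>)
  qed (use int in auto)
  have 2: "((\<lambda>t. integral (cbox 0 (2*pi)) (\<lambda>s. (s - pi) / (2*pi) * f (x + s * of_int p) (t + s * of_int q)))
       has_real_derivative integral (cbox 0 (2*pi)) (\<lambda>s. (s - pi) / (2*pi) * h (x + s * of_int p) (y + s * of_int q)))
       (at y within UNIV)" for x y
  proof (rule leibniz_rule_field_derivative)
    show "continuous_on (UNIV \<times> cbox 0 (2 * pi)) (\<lambda>(t, s). (s - pi) / (2 * pi) * h (x + s * of_int p) (t + s * of_int q))"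
      unfolding case_prod_unfold by (intro continuous_intros cont2_compose[OF assms(4)]) auto
    show "((\<lambda>t. (s - pi) / (2 * pi) * f (x + s * of_int p) (t + s * of_int q)) has_real_derivative
            (s - pi) / (2 * pi) * h (x + s * of_int p) (t + s * of_int q)) (at t within UNIV)" for t s
      by (intro DERIV_cmult) (use hd[of "x + s * of_int p" "t + s * of_int q"] in \<open>simp add: DERIV_shift\<close>)
  qed (use int in auto)
  show ?thesis
    unfolding has_partials_def line_op_def using 1 2 by simp
qed

lemma sp_closure_stepI:
  assumes "has_partials f g h" "periodic2 f" "sp_closure g" "sp_closure h" "cont2 f" "cont2 g" "cont2 h"
  shows "periodic2 f \<and> cont2 f \<and>
    (\<exists>g h. sp_closure g \<and> sp_closure h \<and> cont2 g \<and> cont2 h \<and> has_partials f g h)"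
  using assms by blast

text \<open>Continuity of the partials belongs to the induction claim because differentiating under
  the integral in the \<open>line\<close> case uses it.\<close>

lemma sp_closure_step:
  "sp_closure f \<Longrightarrow> periodic2 f \<and> cont2 f \<and>
    (\<exists>g h. sp_closure g \<and> sp_closure h \<and> cont2 g \<and> cont2 h \<and> has_partials f g h)"
proof (induction rule: sp_closure.induct)
  case (base f)
  show ?case
    by (rule sp_closure_stepI[OF smooth_periodic_has_partials]; intro sp_closure.base smooth_periodic_periodic
        smooth_periodic_cont2 smooth_periodic_dx smooth_periodic_dy base)
next
  case (const c)
  have "has_partials (\<lambda>x y. c) (\<lambda>x y. 0) (\<lambda>x y. 0)"
    by (simp add: has_partials_def)
  moreover have "sp_closure (\<lambda>x y. 0)" by (rule sp_closure.const)
  ultimately show ?case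
    by (elim sp_closure_stepI) (simp_all add: periodic2_def)
next
  case (add f1 f2)
  then obtain g1 h1 g2 h2 where *: "sp_closure g1" "sp_closure h1" "cont2 g1" "cont2 h1" "has_partials f1 g1 h1"
    "sp_closure g2" "sp_closure h2" "cont2 g2" "cont2 h2" "has_partials f2 g2 h2" by blast
  have "has_partials (\<lambda>x y. f1 x y + f2 x y) (\<lambda>x y. g1 x y + g2 x y) (\<lambda>x y. h1 x y + h2 x y)"
    using *(5,10) unfolding has_partials_def by (simp add: DERIV_add)
  moreover have "periodic2 (\<lambda>x y. f1 x y + f2 x y)"
    using add by (simp add: periodic2_def)
  moreover have "sp_closure (\<lambda>x y. g1 x y + g2 x y)" "sp_closure (\<lambda>x y. h1 x y + h2 x y)"
    by (intro sp_closure.add *)+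
  moreover have "cont2 (\<lambda>x y. f1 x y + f2 x y)"
    using add by (simp add: continuous_on_add)
  ultimately show ?case
    by (rule sp_closure_stepI; intro sp_closure.add continuous_on_add *)
next
  case (mult f1 f2)
  then obtain g1 h1 g2 h2 where *: "sp_closure g1" "sp_closure h1" "cont2 g1" "cont2 h1" "has_partials f1 g1 h1"
    "sp_closure g2" "sp_closure h2" "cont2 g2" "cont2 h2" "has_partials f2 g2 h2" by blast
  have "has_partials (\<lambda>x y. f1 x y * f2 x y) (\<lambda>x y. f1 x y * g2 x y + g1 x y * f2 x y) (\<lambda>x y. f1 x y * h2 x y + h1 x y * f2 x y)"
    using *(5,10) unfolding has_partials_def
    by (intro allI conjI) (rule DERIV_mult'; blast)+
  moreover have "periodic2 (\<lambda>x y. f1 x y * f2 x y)"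
    using mult by (simp add: periodic2_def)
  moreover have "sp_closure (\<lambda>x y. f1 x y * g2 x y + g1 x y * f2 x y)" "sp_closure (\<lambda>x y. f1 x y * h2 x y + h1 x y * f2 x y)"
    by (intro sp_closure.add sp_closure.mult * mult(1,2))+
  moreover have "cont2 (\<lambda>x y. f1 x y * f2 x y)"
    using mult by (simp add: continuous_on_mult)
  moreover have "cont2 (\<lambda>x y. f1 x y * g2 x y + g1 x y * f2 x y)" "cont2 (\<lambda>x y. f1 x y * h2 x y + h1 x y * f2 x y)"
    using mult * by (simp_all add: continuous_on_mult continuous_on_add)
  ultimately show ?case
    by (rule sp_closure_stepI)
next
  case (flip f)
  then obtain g h where *: "sp_closure g" "sp_closure h" "cont2 g" "cont2 h" "has_partials f g h" by blast
  have gd: "\<And>x y. ((\<lambda>t. f t y) has_real_derivative g x y) (at x)"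
    using *(5) by (auto simp: has_partials_def)
  \<comment> \<open>The sign is written as the factor \<open>-1\<close>, so that the partial is a
    product with a constant and stays in the class.\<close>
  have "((\<lambda>t. f (- t) y) has_real_derivative (-1) * g (- x) y) (at x)" for x y
    using DERIV_mirror[THEN iffD1, OF gd[of y "-x"]] by simp
  then have "has_partials (\<lambda>x y. f (- x) y) (\<lambda>x y. (-1) * g (- x) y) (\<lambda>x y. h (- x) y)"
    using *(5) by (simp add: has_partials_def)
  moreover have "periodic2 (\<lambda>x y. f (- x) y)"
    using flip periodic2_of_int[of f _ "-1" _ 0] by (simp add: periodic2_def)
  moreover have "sp_closure (\<lambda>x y. (-1) * g (- x) y)" "sp_closure (\<lambda>x y. h (- x) y)"
    by (intro sp_closure.mult sp_closure.const sp_closure.flip *)+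
  moreover have "cont2 (\<lambda>x y. f (- x) y)" "cont2 (\<lambda>x y. (-1) * g (- x) y)" "cont2 (\<lambda>x y. h (- x) y)"
    using cont2_flip[OF *(3)] cont2_flip[OF *(4)] cont2_flip[OF conjunct1[OF conjunct2[OF flip(2)]]]
    by (simp_all add: continuous_on_minus)
  ultimately show ?case by (rule sp_closure_stepI)
next
  case (swap f)
  then obtain g h where *: "sp_closure g" "sp_closure h" "cont2 g" "cont2 h" "has_partials f g h" by blast
  have "has_partials (\<lambda>x y. f y x) (\<lambda>x y. h y x) (\<lambda>x y. g y x)"
    using *(5) by (simp add: has_partials_def)
  moreover have "periodic2 (\<lambda>x y. f y x)"
    using swap by (simp add: periodic2_def)
  moreover have "sp_closure (\<lambda>x y. h y x)" "sp_closure (\<lambda>x y. g y x)"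
    by (rule sp_closure.swap, fact)+
  moreover have "cont2 (\<lambda>x y. f y x)" "cont2 (\<lambda>x y. h y x)" "cont2 (\<lambda>x y. g y x)"
    using cont2_swap[OF *(3)] cont2_swap[OF *(4)] cont2_swap[OF conjunct1[OF conjunct2[OF swap(2)]]]
    by simp_all
  ultimately show ?case by (rule sp_closure_stepI)
next
  case (line f p q)
  then obtain g h where *: "sp_closure g" "sp_closure h" "cont2 g" "cont2 h" "has_partials f g h" by blast
  have per: "f (x + 2*pi) y = f x y" "f x (y + 2*pi) = f x y" for x y
    using line by (simp_all add: periodic2_def)
  have "line_op p q f (x + 2*pi) y = line_op p q f x y" "line_op p q f x (y + 2*pi) = line_op p q f x y" for x y
    using per[of "x + s * real_of_int p" "y + s * real_of_int q" for s]
    by (simp_all add: line_op_def add_ac)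
  then have "periodic2 (line_op p q f)" by (simp add: periodic2_def)
  with has_partials_line_op[OF *(5) _ *(3,4)] show ?case
    by (rule sp_closure_stepI; intro sp_closure.line cont2_line_op * conjunct1[OF conjunct2[OF line(2)]])
qed

lemma sp_closure_imp_smooth_periodic: "sp_closure f \<Longrightarrow> smooth_periodic f"
proof (erule smooth_periodic_coinduct[of sp_closure])
  show "periodic2 f \<and> cont2 f \<and> (\<exists>g h. sp_closure g \<and> sp_closure h \<and> has_partials f g h)" if "sp_closure f" for f
    using sp_closure_step[OF that] by blast
qed

lemma smooth_periodic_const: "smooth_periodic (\<lambda>x y. c)"
  by (intro sp_closure_imp_smooth_periodic sp_closure.const)

lemma smooth_periodic_add: "smooth_periodic f \<Longrightarrow> smooth_periodic g \<Longrightarrow> smooth_periodic (\<lambda>x y. f x y + g x y)"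
  by (rule sp_closure_imp_smooth_periodic, rule sp_closure.add; rule sp_closure.base)

lemma smooth_periodic_mult: "smooth_periodic f \<Longrightarrow> smooth_periodic g \<Longrightarrow> smooth_periodic (\<lambda>x y. f x y * g x y)"
  by (rule sp_closure_imp_smooth_periodic, rule sp_closure.mult; rule sp_closure.base)

lemma smooth_periodic_flip: "smooth_periodic f \<Longrightarrow> smooth_periodic (\<lambda>x y. f (- x) y)"
  by (rule sp_closure_imp_smooth_periodic, rule sp_closure.flip; rule sp_closure.base)

lemma smooth_periodic_swap: "smooth_periodic f \<Longrightarrow> smooth_periodic (\<lambda>x y. f y x)"
  by (rule sp_closure_imp_smooth_periodic, rule sp_closure.swap, rule sp_closure.base)

lemma smooth_periodic_line_op: "smooth_periodic f \<Longrightarrow> smooth_periodic (line_op p q f)"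
  by (rule sp_closure_imp_smooth_periodic, rule sp_closure.line; rule sp_closure.base)

lemma smooth_periodic_diff: "smooth_periodic f \<Longrightarrow> smooth_periodic g \<Longrightarrow> smooth_periodic (\<lambda>x y. f x y - g x y)"
  using smooth_periodic_add[of f "\<lambda>x y. (-1) * g x y"] smooth_periodic_mult[OF smooth_periodic_const[of "-1"], of g]
  by simp

lemma smooth_periodic_sum:
  "(\<And>i. i \<in> I \<Longrightarrow> smooth_periodic (f i)) \<Longrightarrow> smooth_periodic (\<lambda>x y. \<Sum>i\<in>I. f i x y)"
  by (induction I rule: infinite_finite_induct) (simp_all add: smooth_periodic_const smooth_periodic_add)

subsection \<open>Integration over the torus\<close>

text \<open>After removing whole periods the shift \<open>r\<close> lies between 0 and one period.
  The part of the shifted window beyond \<open>2*pi\<close> is moved back by one period and fills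
  the gap at the left end.\<close>

lemma integral_periodic_shift:
  fixes g :: "real \<Rightarrow> 'a::banach"
  assumes cont: "continuous_on UNIV g" and per: "\<And>x. g (x + 2*pi) = g x"
  shows "integral {0..2*pi} (\<lambda>x. g (x + c)) = integral {0..2*pi} g"
proof -
  have shift: "integral {a..b} (\<lambda>x. g (x + d)) = integral {a+d..b+d} g" for a b d
    using has_integral_shift_Icc_real[of g d "integral {a+d..b+d} g" a b]
      integrable_continuous_interval[OF continuous_on_subset[OF cont subset_UNIV]]
    by (intro integral_unique) (simp add: o_def add.commute has_integral_integral)
  have int: "g integrable_on {a..b}" for a b
    by (intro integrable_continuous_interval continuous_on_subset[OF cont]) auto
  define n where "n = \<lfloor>c / (2*pi)\<rfloor>"
  define r where "r = c - 2*pi * of_int n"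
  have "of_int n \<le> c / (2*pi)" "c / (2*pi) < of_int n + 1"
    unfolding n_def using floor_correct by auto
  then have r: "0 \<le> r" "r \<le> 2*pi"
    using pi_gt_zero unfolding r_def by (simp_all add: pos_le_divide_eq pos_divide_less_eq algebra_simps)
  have "g (x + 2*pi * of_int k) = g x" for x k
  proof (induction k rule: int_induct[of _ 0])
    case (step1 i)
    then show ?case using per[of "x + 2*pi * of_int i"] by (simp add: algebra_simps)
  next
    case (step2 i)
    then show ?case using per[of "x + 2*pi * of_int (i - 1)"] by (simp add: algebra_simps)
  qed simp
  from this[of "x + r" n for x] have "integral {0..2*pi} (\<lambda>x. g (x + c)) = integral {0..2*pi} (\<lambda>x. g (x + r))"
    by (simp add: r_def)
  also have "\<dots> = integral {r..2*pi + r} g"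
    using shift[of 0 "2*pi" r] by simp
  also have "\<dots> = integral {r..2*pi} g + integral {2*pi..2*pi+r} g"
    using r by (intro Henstock_Kurzweil_Integration.integral_combine[symmetric] int) auto
  also have "integral {2*pi..2*pi+r} g = integral {0..r} g"
    using shift[of 0 r "2*pi"] per by (simp add: add.commute)
  also have "integral {r..2*pi} g + integral {0..r} g = integral {0..2*pi} g"
    using Henstock_Kurzweil_Integration.integral_combine[OF r int] by (simp add: add.commute)
  finally show ?thesis .
qed

text \<open>Shifting by one period turns the integrand into \<open>g (2*pi - x)\<close>, whose
  reflection maps the interval of integration onto itself.\<close>

lemma integral_periodic_reflect:
  fixes g :: "real \<Rightarrow> 'a::banach"
  assumes cont: "continuous_on UNIV g" and per: "\<And>x. g (x + 2*pi) = g x"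
  shows "integral {0..2*pi} (\<lambda>x. g (- x)) = integral {0..2*pi} g"
proof -
  have c: "continuous_on UNIV (\<lambda>x. g (- x))"
    by (intro continuous_on_compose2[OF cont] continuous_intros) auto
  have p: "g (- (x + 2*pi)) = g (- x)" for x
    using per[of "- x - 2*pi"] by simp
  have "integral {0..2*pi} (\<lambda>x. g (- x)) = integral {0..2*pi} (\<lambda>x. g (2*pi - x))"
    using integral_periodic_shift[OF c p, of "-2*pi"] by (simp add: algebra_simps)
  also have "\<dots> = integral {-(2*pi)..-0} (\<lambda>x. g (x + 2*pi))"
    using Henstock_Kurzweil_Integration.integral_reflect_real[of "2*pi" 0 "\<lambda>x. g (2*pi - x)"] by (simp add: add.commute)
  also have "\<dots> = integral {0..2*pi} g"
    using has_integral_shift_Icc_real[of g "2*pi" "integral {0..2*pi} g" "-2*pi" 0]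
      integrable_continuous_interval[OF continuous_on_subset[OF cont subset_UNIV]]
    by (intro integral_unique) (simp add: o_def add.commute has_integral_integral)
  finally show ?thesis .
qed

abbreviation per2 :: "(real \<Rightarrow> real \<Rightarrow> 'a) \<Rightarrow> bool" where
  "per2 G \<equiv> (\<forall>x y. G (x + 2*pi) y = G x y \<and> G x (y + 2*pi) = G x y)"

definition torus_int :: "(real \<Rightarrow> real \<Rightarrow> 'a::banach) \<Rightarrow> 'a" where
  "torus_int G = integral (cbox (0,0) (2*pi, 2*pi)) (\<lambda>z::real\<times>real. G (fst z) (snd z))"

lemma torus_int_iterated:
  assumes "cont2 G"
  shows "torus_int G = integral {0..2*pi} (\<lambda>x. integral {0..2*pi} (\<lambda>y. G x y))"
  unfolding torus_int_def
  using integral_prod_continuous[of 0 0 "2*pi" "2*pi" "\<lambda>z. G (fst z) (snd z)"]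
    continuous_on_subset[OF assms] by simp

lemma torus_int_swap:
  assumes "cont2 G"
  shows "torus_int (\<lambda>x y. G y x) = torus_int G"
proof -
  have "continuous_on (cbox (0,0) (2*pi,2*pi)) (\<lambda>(x, y). G x y)"
    using continuous_on_subset[OF assms] by (simp add: case_prod_unfold)
  from integral_swap_continuous[OF this] show ?thesis
    by (simp add: torus_int_iterated[OF assms] torus_int_iterated[OF cont2_swap[OF assms]])
qed

lemma torus_int_shift_snd:
  assumes "cont2 G" "per2 G"
  shows "torus_int (\<lambda>x y. G x (y + d)) = torus_int G"
proof -
  have c: "cont2 (\<lambda>x y. G x (y + d))"
    by (intro cont2_compose[OF assms(1)] continuous_intros)
  have "integral {0..2*pi} (\<lambda>y. G x (y + d)) = integral {0..2*pi} (G x)" for x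
    using assms by (intro integral_periodic_shift cont2_compose[OF assms(1)] continuous_intros) auto
  then show ?thesis by (simp add: torus_int_iterated assms c)
qed

text \<open>The inner integral of the iterated form handles the second coordinate; exchanging the
  coordinates reduces the first one to that case.\<close>

lemma torus_int_shift:
  assumes "cont2 G" "per2 G"
  shows "torus_int (\<lambda>x y. G (x + c) (y + d)) = torus_int G"
proof -
  have c1: "cont2 (\<lambda>x y. G (x + c) y)"
    by (intro cont2_compose[OF assms(1)] continuous_intros)
  have p1: "per2 (\<lambda>x y. G (x + c) y)"
    using assms(2)[rule_format, of "x + c" y for x y] by (simp add: add_ac)
  have "torus_int (\<lambda>x y. G (x + c) (y + d)) = torus_int (\<lambda>x y. G (x + c) y)"
    using torus_int_shift_snd[OF c1 p1] .
  also have "\<dots> = torus_int (\<lambda>x y. G (y + c) x)"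
    using torus_int_swap[OF c1] by simp
  also have "\<dots> = torus_int (\<lambda>x y. G y x)"
    using torus_int_shift_snd[OF cont2_swap[OF assms(1)]] assms(2) by blast
  finally show ?thesis using torus_int_swap[OF assms(1)] by simp
qed

lemma torus_int_flip:
  assumes "cont2 G" "per2 G"
  shows "torus_int (\<lambda>x y. G (- x) y) = torus_int G"
proof -
  have c: "cont2 (\<lambda>x y. G (- y) x)"
    by (intro cont2_compose[OF assms(1)] continuous_intros)
  have "torus_int (\<lambda>x y. G (- y) x) = torus_int (\<lambda>x y. G y x)"
  proof -
    have "integral {0..2*pi} (\<lambda>y. G (- y) x) = integral {0..2*pi} (\<lambda>y. G y x)" for x
      using assms by (intro integral_periodic_reflect[of "\<lambda>y. G y x"] cont2_compose[OF assms(1)] continuous_intros) auto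
    then show ?thesis by (simp add: torus_int_iterated assms cont2_swap c)
  qed
  then show ?thesis
    using torus_int_swap[OF cont2_flip[OF assms(1)]] torus_int_swap[OF assms(1)] by simp
qed

text \<open>Integration by parts without boundary terms: the fundamental theorem leaves a difference
  of values one period apart.\<close>

lemma torus_int_dy:
  assumes "cont2 H" "per2 G"
    and "\<And>x y. ((\<lambda>t. G x t) has_vector_derivative H x y) (at y)"
  shows "torus_int H = 0"
proof -
  have "integral {0..2*pi} (H x) = 0" for x
  proof -
    have "(H x has_integral (G x (2*pi) - G x 0)) {0..2*pi}"
      by (rule fundamental_theorem_of_calculus, simp, rule has_vector_derivative_at_within, rule assms(3))
    then show ?thesis using assms(2)[rule_format, of x 0] by (simp add: integral_unique)
  qed
  then show ?thesis by (simp add: torus_int_iterated assms)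
qed

lemma torus_int_dx:
  assumes "cont2 H" "per2 G"
    and "\<And>x y. ((\<lambda>t. G t y) has_vector_derivative H x y) (at x)"
  shows "torus_int H = 0"
  using torus_int_dy[OF cont2_swap[OF assms(1)], of "\<lambda>x y. G y x"] torus_int_swap[OF assms(1)] assms(2,3)
  by simp

lemma torus_int_integrable:
  "cont2 G \<Longrightarrow> (\<lambda>z. G (fst z) (snd z)) integrable_on cbox (0,0) (2*pi,2*pi)" for G :: "real \<Rightarrow> real \<Rightarrow> 'a::banach"
  by (rule integrable_continuous, erule continuous_on_subset) simp

lemma torus_int_add:
  "cont2 G \<Longrightarrow> cont2 H \<Longrightarrow> torus_int (\<lambda>x y. G x y + H x y) = torus_int G + torus_int H"
  unfolding torus_int_def by (intro integral_add torus_int_integrable)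

lemma torus_int_diff:
  "cont2 G \<Longrightarrow> cont2 H \<Longrightarrow> torus_int (\<lambda>x y. G x y - H x y) = torus_int G - torus_int H"
  unfolding torus_int_def by (intro integral_diff torus_int_integrable)

lemma torus_int_mult: "torus_int (\<lambda>x y. c * G x y) = c * torus_int G"
  for c :: "'a::{banach,real_normed_field,euclidean_space}"
  unfolding torus_int_def by simp

subsection \<open>Fourier coefficients\<close>

text \<open>The conjugate character, with the minus sign built in, so that a Fourier coefficient is
  a plain integral against \<open>ch m n\<close>.\<close>

definition ch :: "int \<Rightarrow> int \<Rightarrow> real \<Rightarrow> real \<Rightarrow> complex" where
  "ch m n x y = exp (- \<i> * complex_of_real (of_int m * x + of_int n * y))"

lemma fcoeff_torus_int: "fcoeff f m n = torus_int (\<lambda>x y. of_real (f x y) * ch m n x y) / (4 * pi\<^sup>2)"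
  by (simp add: fcoeff_def torus_int_def ch_def)

lemma cont2_ch: "cont2 (ch m n)"
  unfolding ch_def by (intro continuous_intros)

lemma ch_cis: "ch m n x y = cis (- (of_int m * x + of_int n * y))"
  by (simp add: ch_def cis_conv_exp algebra_simps)

lemma per2_ch: "per2 (ch m n)"
proof -
  have "cis (2 * pi * of_int k) = 1" for k
    using cis_multiple_2pi[of "of_int k"] by simp
  then have "ch m n (x + 2*pi) y = ch m n x y" "ch m n x (y + 2*pi) = ch m n x y" for x y
    by (auto simp: ch_cis algebra_simps simp flip: cis_mult cis_divide)
  then show ?thesis by blast
qed

lemma cont2_times_ch:
  assumes "cont2 f" shows "cont2 (\<lambda>x y. complex_of_real (f x y) * ch m n x y)"
  by (intro continuous_intros assms cont2_ch)

lemma fcoeff_add: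
  "cont2 f \<Longrightarrow> cont2 g \<Longrightarrow> fcoeff (\<lambda>x y. f x y + g x y) m n = fcoeff f m n + fcoeff g m n"
  using torus_int_add[OF cont2_times_ch[of f m n] cont2_times_ch[of g m n]]
  by (simp add: fcoeff_torus_int distrib_right add_divide_distrib)

lemma fcoeff_diff:
  "cont2 f \<Longrightarrow> cont2 g \<Longrightarrow> fcoeff (\<lambda>x y. f x y - g x y) m n = fcoeff f m n - fcoeff g m n"
  using torus_int_diff[OF cont2_times_ch[of f m n] cont2_times_ch[of g m n]]
  by (simp add: fcoeff_torus_int left_diff_distrib diff_divide_distrib)

lemma fcoeff_uminus: "fcoeff (\<lambda>x y. - f x y) m n = - fcoeff f m n"
  using torus_int_mult[of "-1" "\<lambda>x y. of_real (f x y) * ch m n x y"]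
  by (simp add: fcoeff_torus_int)

lemma fcoeff_dx:
  assumes "smooth_periodic f"
  shows "fcoeff (dx f) m n = \<i> * of_int m * fcoeff f m n"
proof -
  have c: "cont2 f" "cont2 (dx f)"
    using assms by (auto intro: smooth_periodic_cont2 smooth_periodic_dx)
  \<comment> \<open>The integrand is the \<open>x\<close>-derivative of the periodic function
    \<open>f * ch m n\<close>.\<close>
  have "torus_int (\<lambda>x y. of_real (dx f x y) * ch m n x y - (\<i> * of_int m) * (of_real (f x y) * ch m n x y)) = 0"
  proof (rule torus_int_dx)
    show "per2 (\<lambda>x y. of_real (f x y) * ch m n x y)"
      using smooth_periodic_periodic[OF assms] per2_ch[of m n] by (simp add: periodic2_def)
    show "cont2 (\<lambda>x y. complex_of_real (dx f x y) * ch m n x y - (\<i> * of_int m) * (of_real (f x y) * ch m n x y))"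
      by (intro continuous_intros cont2_times_ch c)
    fix x y
    have d: "((\<lambda>t. f t y) has_real_derivative dx f x y) (at x)"
      using smooth_periodic_has_partials[OF assms] by (simp add: has_partials_def)
    have "((\<lambda>t. ch m n t y) has_vector_derivative (- \<i> * of_int m * ch m n x y)) (at x)"
      unfolding ch_def
      by (auto intro!: derivative_eq_intros has_vector_derivative_real_field simp: algebra_simps)
    from has_vector_derivative_mult[OF has_vector_derivative_of_real[OF d] this]
    show "((\<lambda>t. complex_of_real (f t y) * ch m n t y) has_vector_derivative
        complex_of_real (dx f x y) * ch m n x y - (\<i> * of_int m) * (of_real (f x y) * ch m n x y)) (at x)"
      by (simp add: algebra_simps)
  qed
  then have "torus_int (\<lambda>x y. of_real (dx f x y) * ch m n x y) = (\<i> * of_int m) * torus_int (\<lambda>x y. of_real (f x y) * ch m n x y)"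
    by (subst (asm) torus_int_diff) (auto intro!: continuous_intros cont2_times_ch c simp: torus_int_mult cont2_ch)
  then show ?thesis by (simp add: fcoeff_torus_int)
qed

lemma fcoeff_swap:
  assumes "cont2 f" shows "fcoeff (\<lambda>x y. f y x) m n = fcoeff f n m"
  using torus_int_swap[OF cont2_times_ch[OF assms, of n m]]
  by (simp add: fcoeff_torus_int ch_def add.commute)

lemma fcoeff_flip:
  assumes "cont2 f" "periodic2 f" shows "fcoeff (\<lambda>x y. f (- x) y) m n = fcoeff f (- m) n"
proof -
  have "per2 (\<lambda>x y. of_real (f x y) * ch (- m) n x y)"
    using assms(2) per2_ch[of "-m" n] by (simp add: periodic2_def)
  from torus_int_flip[OF cont2_times_ch[OF assms(1)] this] show ?thesis
    by (simp add: fcoeff_torus_int ch_def)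
qed

lemma dx_swap: "dx (\<lambda>x y. f y x) = (\<lambda>x y. dy f y x)"
  by (simp add: dx_def dy_def)

lemma fcoeff_dy:
  assumes "smooth_periodic f"
  shows "fcoeff (dy f) m n = \<i> * of_int n * fcoeff f m n"
  using fcoeff_dx[OF smooth_periodic_swap[OF assms], of n m] assms
  by (simp add: dx_swap fcoeff_swap smooth_periodic_cont2 smooth_periodic_dy)

section \<open>Fourier integrals of the sawtooth kernel and the multipliers of the line
  averages\<close>

definition kappa :: "int \<Rightarrow> complex" where
  "kappa j = integral {0..2*pi} (\<lambda>s. of_real ((s - pi) / (2*pi)) * cis (s * of_int j))"

text \<open>The sawtooth has mean zero; this is what makes a line average annihilate the modes that
  are constant along the line.\<close>

lemma kappa_0: "kappa 0 = 0"
proof -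
  have "((\<lambda>s. complex_of_real ((s - pi) / (2*pi)) * cis (s * of_int 0)) has_integral
     (of_real ((2*pi - pi)^2 / (4*pi)) - of_real ((0 - pi)^2 / (4*pi)))) {0..2*pi}"
  proof (rule fundamental_theorem_of_calculus)
    fix x assume "x \<in> {0..2*pi}"
    have "((\<lambda>s. (s - pi)^2 / (4*pi)) has_real_derivative (x - pi) / (2*pi)) (at x)"
      by (auto intro!: derivative_eq_intros simp: field_simps)
    from has_vector_derivative_at_within[OF has_vector_derivative_of_real[OF this]]
    show "((\<lambda>s. complex_of_real ((s - pi)^2 / (4*pi))) has_vector_derivative
            of_real ((x - pi) / (2*pi)) * cis (x * of_int 0)) (at x within {0..2*pi})"
      unfolding of_int_0 mult_zero_right cis_zero mult_1_right .
  qed simp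
  from integral_unique[OF this] show ?thesis by (simp only: kappa_def) (simp add: power2_eq_square)
qed

lemma kappa_nz:
  assumes "j \<noteq> 0" shows "kappa j = 1 / (\<i> * of_int j)"
proof -
  \<comment> \<open>An antiderivative found by integrating by parts once. The exponential equals 1
    at both ends, so only the jump of the sawtooth from \<open>-1/2\<close> to \<open>1/2\<close>
    survives in \<open>F (2*pi) - F 0\<close>.\<close>
  define F where "F = (\<lambda>s. of_real ((s - pi) / (2*pi)) * (exp (\<i> * of_int j * of_real s) / (\<i> * of_int j))
                          + exp (\<i> * of_int j * of_real s) / (2 * pi * (of_int j)^2))"
  have cis: "cis (s * of_int j) = exp (\<i> * of_int j * of_real s)" for s
    by (simp add: cis_conv_exp algebra_simps)
  have "((\<lambda>s. complex_of_real ((s - pi) / (2*pi)) * cis (s * of_int j)) has_integral (F (2*pi) - F 0)) {0..2*pi}"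
  proof (rule fundamental_theorem_of_calculus)
    fix x assume "x \<in> {0..2*pi}"
    have 1: "((\<lambda>s. (s - pi) / (2*pi)) has_real_derivative 1 / (2*pi)) (at x)"
      by (auto intro!: derivative_eq_intros)
    have 2: "((\<lambda>s. exp (\<i> * of_int j * of_real s)) has_vector_derivative (\<i> * of_int j * exp (\<i> * of_int j * of_real x))) (at x)"
      by (rule has_vector_derivative_real_field) (auto intro!: derivative_eq_intros)
    have "(F has_vector_derivative
            (of_real ((x - pi) / (2*pi)) * (\<i> * of_int j * exp (\<i> * of_int j * of_real x) / (\<i> * of_int j))
             + of_real (1 / (2*pi)) * (exp (\<i> * of_int j * of_real x) / (\<i> * of_int j))
             + \<i> * of_int j * exp (\<i> * of_int j * of_real x) / (2 * pi * (of_int j)^2))) (at x)"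
      unfolding F_def
      by (intro has_vector_derivative_add has_vector_derivative_mult has_vector_derivative_of_real[OF 1]
           has_vector_derivative_divide 2)
    moreover have "\<i> * of_int j * E / (\<i> * of_int j) = E"
      "of_real (1 / (2*pi)) * (E / (\<i> * of_int j)) = - (\<i> * of_int j * E / (2 * pi * (of_int j)^2))" for E
      using assms by (simp_all add: field_simps power2_eq_square)
    ultimately show "(F has_vector_derivative of_real ((x - pi) / (2*pi)) * cis (x * of_int j)) (at x within {0..2*pi})"
      unfolding cis by (intro has_vector_derivative_at_within[of _ _ _ "{0..2*pi}"]) (simp del: of_real_diff of_real_divide)
  qed simp
  moreover have "exp (\<i> * of_int j * of_real (2*pi)) = 1"
    using cis[of "2*pi"] cis_multiple_2pi[of "of_int j"] by simp
  then have "F (2*pi) - F 0 = 1 / (\<i> * of_int j)"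
    by (simp add: F_def field_simps)
  ultimately show ?thesis by (simp only: kappa_def integral_unique)
qed

text \<open>After exchanging the integrals, translation invariance of the torus integral removes the
  displacement along the line, and the remaining integral of kernel times phase is
  \<open>kappa\<close>.\<close>

lemma fcoeff_line_op:
  assumes "cont2 f" "periodic2 f"
  shows "fcoeff (line_op p q f) m n = kappa (m * p + n * q) * fcoeff f m n"
proof -
  let ?k = "\<lambda>s. (s - pi) / (2*pi)"
  let ?G = "\<lambda>x y. complex_of_real (f x y) * ch m n x y"
  let ?c = "\<lambda>s::real. cis (s * of_int (m * p + n * q))"
  \<comment> \<open>Moving the character along the line costs the phase \<open>?c s\<close>, which
    does not depend on the base point.\<close>
  have chs: "ch m n x y = ?c s * ch m n (x + s * of_int p) (y + s * of_int q)" for x y s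
    by (simp add: ch_cis cis_mult algebra_simps)
  have cont: "continuous_on UNIV (\<lambda>w::(real\<times>real)\<times>real. complex_of_real (?k (snd w)) *
      (?c (snd w) * ?G (fst (fst w) + snd w * of_int p) (snd (fst w) + snd w * of_int q)))"
    by (intro continuous_intros cont2_compose[OF assms(1)] cont2_compose[OF cont2_ch]) auto
  have perG: "per2 ?G" using assms(2) per2_ch[of m n] by (simp add: periodic2_def)
  have "of_real (line_op p q f x y) * ch m n x y =
     integral (cbox 0 (2*pi)) (\<lambda>s. of_real (?k s) * (?c s * ?G (x + s * of_int p) (y + s * of_int q)))" for x y
  proof -
    have "(\<lambda>s. ?k s * f (x + s * of_int p) (y + s * of_int q)) integrable_on {0..2*pi}"
      by (intro integrable_continuous_interval continuous_intros cont2_compose[OF assms(1)]) auto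
    then have "((\<lambda>s. complex_of_real (?k s * f (x + s * of_int p) (y + s * of_int q)) * ch m n x y) has_integral
        of_real (line_op p q f x y) * ch m n x y) {0..2*pi}"
      unfolding line_op_def by (intro has_integral_mult_left has_integral_of_real integrable_integral)
    moreover have "complex_of_real (?k s * f (x + s * of_int p) (y + s * of_int q)) * ch m n x y =
        of_real (?k s) * (?c s * ?G (x + s * of_int p) (y + s * of_int q))" for s
      by (subst chs[of x y s]) (simp add: mult_ac)
    ultimately show ?thesis by (simp only: integral_unique cbox_interval)
  qed
  then have "torus_int (\<lambda>x y. of_real (line_op p q f x y) * ch m n x y) =
    integral (cbox (0,0) (2*pi,2*pi)) (\<lambda>z. integral (cbox 0 (2*pi))
      (\<lambda>s. of_real (?k s) * (?c s * ?G (fst z + s * of_int p) (snd z + s * of_int q))))"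
    by (simp add: torus_int_def)
  also have "\<dots> = integral (cbox 0 (2*pi)) (\<lambda>s. integral (cbox (0,0) (2*pi,2*pi)) 
      (\<lambda>z. of_real (?k s) * (?c s * ?G (fst z + s * of_int p) (snd z + s * of_int q))))"
    by (rule integral_swap_continuous, unfold case_prod_unfold, rule continuous_on_subset[OF cont subset_UNIV])
  also have "\<dots> = integral (cbox 0 (2*pi)) (\<lambda>s. of_real (?k s) * (?c s * torus_int ?G))"
  proof -
    have "integral (cbox (0,0) (2*pi,2*pi)) (\<lambda>z. of_real (?k s) * (?c s * ?G (fst z + s * of_int p) (snd z + s * of_int q)))
      = of_real (?k s) * (?c s * torus_int ?G)" for s
      using torus_int_shift[OF cont2_times_ch[OF assms(1)] perG, of "s * of_int p" "s * of_int q"]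
      by (simp add: torus_int_def)
    then show ?thesis by (simp only:)
  qed
  also have "\<dots> = kappa (m * p + n * q) * torus_int ?G"
    by (simp add: kappa_def mult.assoc[symmetric])
  finally show ?thesis by (simp add: fcoeff_torus_int)
qed

section \<open>Completeness of the characters\<close>

text \<open>Passing to the product of two circles gives a compact subset of a Euclidean space, where
  polynomial approximation is available.\<close>

lemma torus_factor:
  fixes f :: "real \<Rightarrow> real \<Rightarrow> real"
  assumes "cont2 f" "periodic2 f"
  obtains F where "continuous_on (sphere 0 1 \<times> sphere 0 1) F" "\<And>x y. F (cis x, cis y) = f x y"
proof
  let ?F = "\<lambda>z::complex\<times>complex. f (Arg (fst z)) (Arg (snd z))"
  let ?e = "\<lambda>z::real\<times>real. (cis (fst z), cis (snd z))"
  have cis_Arg_1: "cis (Arg z) = z" if "cmod z = 1" for z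
  proof -
    have "z \<noteq> 0" using that by auto
    then show ?thesis using that by (simp add: cis_Arg sgn_div_norm)
  qed
  show F: "?F (cis x, cis y) = f x y" for x y
  proof -
    have "\<exists>k::int. Arg (cis t) = t + 2*pi * of_int k" for t
    proof -
      have "cis (Arg (cis t)) = cis t" by (simp add: cis_Arg_1)
      then have "sin (Arg (cis t)) = sin t \<and> cos (Arg (cis t)) = cos t"
        by (simp add: complex_eq_iff)
      then obtain k where "Arg (cis t) = t + 2 * pi * of_int k" using sin_cos_eq_iff by auto
      then show ?thesis by auto
    qed
    then obtain k l :: int where "Arg (cis x) = x + 2*pi * of_int k" "Arg (cis y) = y + 2*pi * of_int l" by meson
    then show ?thesis using periodic2_of_int[OF assms(2)] by simp
  qed
  show "continuous_on (sphere 0 1 \<times> sphere 0 1) ?F"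
  \<comment> \<open>\<open>Arg\<close> jumps across its cut, so continuity does not follow by
    composition. Instead the preimage of a closed set is exhibited as the part on the torus of the
    image of a compact subset of the square \<open>[-pi, pi] x [-pi, pi]\<close>.\<close>
  proof (subst continuous_on_closed_invariant, intro allI impI)
    fix B :: "real set" assume "closed B"
    let ?K = "cbox (-pi,-pi) (pi,pi) \<inter> (\<lambda>z. f (fst z) (snd z)) -` B"
    have "closed ((\<lambda>z. f (fst z) (snd z)) -` B)"
      using assms(1) \<open>closed B\<close> by (simp add: continuous_on_closed_vimage)
    then have "compact ?K" by (intro compact_Int_closed compact_cbox)
    then have "compact (?e ` ?K)"
      by (intro compact_continuous_image continuous_intros) auto
    moreover have "?e ` ?K \<inter> (sphere 0 1 \<times> sphere 0 1) = ?F -` B \<inter> (sphere 0 1 \<times> sphere 0 1)"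
    proof (intro equalityI subsetI)
      fix w assume "w \<in> ?e ` ?K \<inter> (sphere 0 1 \<times> sphere 0 1)"
      then show "w \<in> ?F -` B \<inter> (sphere 0 1 \<times> sphere 0 1)" using F by auto
    next
      fix w assume w: "w \<in> ?F -` B \<inter> (sphere 0 1 \<times> sphere 0 1)"
      have "w = ?e (Arg (fst w), Arg (snd w))"
        using w by (auto simp: cis_Arg_1 prod_eq_iff)
      moreover have "(Arg (fst w), Arg (snd w)) \<in> ?K"
        using w Arg_bounded by (auto simp: less_imp_le)
      ultimately show "w \<in> ?e ` ?K \<inter> (sphere 0 1 \<times> sphere 0 1)" using w by blast
    qed
    ultimately show "\<exists>A. closed A \<and> A \<inter> sphere 0 1 \<times> sphere 0 1 = ?F -` B \<inter> sphere 0 1 \<times> sphere 0 1"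
      using compact_imp_closed by blast
  qed
qed

lemma cont2_polynomial_cis:
  assumes "real_polynomial_function P"
  shows "cont2 (\<lambda>x y. complex_of_real (P (cis x, cis y)))"
  by (intro continuous_on_of_real continuous_on_compose2[OF continuous_on_polymonial_function[of P UNIV]]
        continuous_intros) (use assms in \<open>auto simp: real_polynomial_function_eq\<close>)

text \<open>Stated for a general \<open>G\<close> so that the induction on the polynomial goes through without expanding
  it into a trigonometric sum.\<close>

lemma orthogonal_mult_polynomial:
  assumes "real_polynomial_function P" "cont2 G" "\<And>m n. torus_int (\<lambda>x y. G x y * ch m n x y) = 0"
  shows "torus_int (\<lambda>x y. (of_real (P (cis x, cis y)) * G x y) * ch m n x y) = 0"
  using assms
proof (induction arbitrary: G m n rule: real_polynomial_function.induct)
  case (linear P)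
  note G = linear.prems
  have c: "cont2 (\<lambda>x y. k * (G x y * ch m n x y))" for k m n
    by (intro continuous_on_mult continuous_on_const G cont2_ch)
  \<comment> \<open>A real linear functional on pairs of complex numbers is determined by its values
    on these four basis vectors.\<close>
  define a1 a2 b1 b2 where "a1 = P (1, 0)" "a2 = P (\<i>, 0)" "b1 = P (0, 1)" "b2 = P (0, \<i>)"
  interpret bounded_linear P by fact
  have P: "P (cis x, cis y) = cos x * a1 + sin x * a2 + cos y * b1 + sin y * b2" for x y
  proof -
    have "(cis x, cis y) = cos x *\<^sub>R (1,0) + sin x *\<^sub>R (\<i>,0) + cos y *\<^sub>R (0,1) + sin y *\<^sub>R (0,\<i>)"
      by (simp add: complex_eq_iff)
    then show ?thesis by (simp only: add scaleR a1_a2_b1_b2_def real_scaleR_def)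
  qed
  have cs: "complex_of_real (cos t) = (cis t + cis (- t)) / 2" "complex_of_real (sin t) = (cis (- t) - cis t) * (\<i> / 2)" for t
    by (simp_all add: complex_eq_iff)
  \<comment> \<open>By Euler's formulas, multiplying by a cosine or sine only moves one index of the
    character by one, so the orthogonality assumed at all modes applies to each summand.\<close>
  have eq: "of_real (P (cis x, cis y)) * G x y * ch m n x y =
     (of_real a1 / 2 - \<i> / 2 * of_real a2) * (G x y * ch (m - 1) n x y)
   + (of_real a1 / 2 + \<i> / 2 * of_real a2) * (G x y * ch (m + 1) n x y)
   + (of_real b1 / 2 - \<i> / 2 * of_real b2) * (G x y * ch m (n - 1) x y)
   + (of_real b1 / 2 + \<i> / 2 * of_real b2) * (G x y * ch m (n + 1) x y)" for x y
  proof -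
    have sh: "ch (m - 1) n x y = cis x * ch m n x y" "ch (m + 1) n x y = cis (- x) * ch m n x y"
      "ch m (n - 1) x y = cis y * ch m n x y" "ch m (n + 1) x y = cis (- y) * ch m n x y"
      by (simp_all add: ch_cis cis_mult algebra_simps)
    show ?thesis unfolding sh P of_real_add of_real_mult cs by (simp add: field_simps)
  qed
  show ?case
    unfolding eq
    by (simp add: torus_int_add continuous_on_add c torus_int_mult G)
next
  case (const c)
  then show ?case using torus_int_mult[of "of_real c" "\<lambda>x y. G x y * ch m n x y"] by (simp add: mult.assoc)
next
  case (add f g)
  have "torus_int (\<lambda>x y. of_real (f (cis x, cis y)) * G x y * ch m n x y + of_real (g (cis x, cis y)) * G x y * ch m n x y) = 0"
    by (subst torus_int_add; (intro continuous_on_mult cont2_polynomial_cis cont2_ch add)?) (simp add: add)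
  then show ?case by (simp add: distrib_right)
next
  case (mult f g)
  have "cont2 (\<lambda>x y. of_real (g (cis x, cis y)) * G x y)"
    by (intro continuous_on_mult cont2_polynomial_cis mult)
  \<comment> \<open>The hypothesis for \<open>f\<close> is applied to \<open>g\<close> times
    \<open>G\<close>, whose orthogonality is the hypothesis for \<open>g\<close>.\<close>
  from mult.IH(1)[OF this mult.IH(2)] mult.prems show ?case by (simp add: mult.assoc)
qed

lemma torus_int_of_real:
  "cont2 f \<Longrightarrow> torus_int (\<lambda>x y. complex_of_real (f x y)) = of_real (torus_int f)"
  unfolding torus_int_def
  by (intro integral_unique has_integral_of_real integrable_integral torus_int_integrable)

text \<open>Vanishing coefficients make \<open>f\<close> orthogonal to every polynomial
  \<open>P\<close> in the circle coordinates, so the integral of \<open>f * f\<close> equals that of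
  \<open>(f - P) * f\<close>, which is arbitrarily small. A nonnegative continuous function with
  integral zero vanishes.\<close>

lemma fcoeff_eq_0_imp_eq_0:
  assumes "cont2 f" "periodic2 f" and zero: "\<And>m n. fcoeff f m n = 0"
  shows "f x y = 0"
proof -
  let ?box = "cbox (0,0) (2*pi,2*pi) :: (real\<times>real) set"
  let ?V = "measure lborel ?box"
  obtain F where F: "continuous_on (sphere 0 1 \<times> sphere 0 1) F" "\<And>x y. F (cis x, cis y) = f x y"
    using torus_factor[OF assms(1,2)] by blast
  have orth: "torus_int (\<lambda>x y. of_real (f x y) * ch m n x y) = 0" for m n
    using zero[of m n] by (simp add: fcoeff_torus_int)
  have "compact ((\<lambda>z. f (fst z) (snd z)) ` ?box)"
    by (intro compact_continuous_image continuous_on_subset[OF assms(1)]) auto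
  then obtain M where M: "\<And>z. z \<in> ?box \<Longrightarrow> \<bar>f (fst z) (snd z)\<bar> \<le> M" "M > 0"
    using compact_imp_bounded bounded_pos by (metis (no_types, lifting) image_eqI real_norm_def)
  have ff: "cont2 (\<lambda>x y. f x y * f x y)" by (intro continuous_on_mult assms)
  let ?I = "torus_int (\<lambda>x y. f x y * f x y)"
  have "\<bar>?I\<bar> \<le> e" if e: "e > 0" for e
  proof -
    \<comment> \<open>Chosen so that \<open>d * M * (?V + 1) = e\<close>; adding 1 keeps the
      denominator positive without computing the area.\<close>
    define d where "d = e / (M * (?V + 1))"
    have V: "?V + 1 \<noteq> 0" using measure_nonneg[of lborel ?box] by linarith
    have d: "d > 0" using e M by (simp add: d_def add_nonneg_pos)
    obtain P where P: "real_polynomial_function P" "\<And>z. z \<in> sphere 0 1 \<times> sphere 0 1 \<Longrightarrow> \<bar>F z - P z\<bar> < d"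
      using Stone_Weierstrass_real_polynomial_function[OF _ F(1) d] compact_Times[OF compact_sphere compact_sphere] by metis
    have cP: "cont2 (\<lambda>x y. of_real (P (cis x, cis y)) * complex_of_real (f x y))"
      by (intro continuous_on_mult cont2_polynomial_cis P continuous_on_of_real assms)
    have cf: "cont2 (\<lambda>x y. complex_of_real (f x y))"
      by (intro continuous_on_of_real assms)
    have cff: "cont2 (\<lambda>x y. complex_of_real (f x y * f x y))"
      by (intro continuous_on_of_real ff)
    have "torus_int (\<lambda>x y. of_real (P (cis x, cis y)) * complex_of_real (f x y)) = 0"
      using orthogonal_mult_polynomial[OF P(1) cf orth, of 0 0] by (simp add: ch_def)
    then have "of_real ?I = torus_int (\<lambda>x y. complex_of_real (f x y * f x y) - of_real (P (cis x, cis y)) * complex_of_real (f x y))"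
      using torus_int_diff[OF cff cP] torus_int_of_real[OF ff] by simp
    moreover have "norm \<dots> \<le> d * M * ?V"
      unfolding torus_int_def
    proof (rule has_integral_bound[OF _ integrable_integral[OF torus_int_integrable[OF continuous_on_diff[OF cff cP]]]])
      show "0 \<le> d * M" using d M by simp
      fix z assume z: "z \<in> ?box"
      have "\<bar>f (fst z) (snd z) - P (cis (fst z), cis (snd z))\<bar> \<le> d"
        using P(2)[of "(cis (fst z), cis (snd z))"] F(2) by (simp add: less_imp_le)
      then have "\<bar>f (fst z) (snd z) - P (cis (fst z), cis (snd z))\<bar> * \<bar>f (fst z) (snd z)\<bar> \<le> d * M"
        using M(1)[OF z] d by (intro mult_mono) auto
      moreover have "norm (complex_of_real (f (fst z) (snd z) * f (fst z) (snd z)) - of_real (P (cis (fst z), cis (snd z))) * of_real (f (fst z) (snd z)))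
         = norm (complex_of_real ((f (fst z) (snd z) - P (cis (fst z), cis (snd z))) * f (fst z) (snd z)))"
        by (simp only: of_real_mult of_real_diff left_diff_distrib)
      ultimately show "norm (complex_of_real (f (fst z) (snd z) * f (fst z) (snd z)) - of_real (P (cis (fst z), cis (snd z))) * of_real (f (fst z) (snd z))) \<le> d * M"
        by (simp only: norm_of_real abs_mult)
    qed
    ultimately have "\<bar>?I\<bar> \<le> d * M * ?V" by (metis norm_of_real)
    also have "\<dots> \<le> d * M * (?V + 1)" using d M by simp
    also have "\<dots> = e" using M(2) V by (simp add: d_def)
    finally show ?thesis .
  qed
  then have "\<bar>?I\<bar> \<le> 0" by - (rule field_le_epsilon, simp only: add_0)
  then have "?I = 0" by (simp only: abs_le_zero_iff)
  then have I0: "integral ?box (\<lambda>z. f (fst z) (snd z) * f (fst z) (snd z)) = 0"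
    by (simp only: torus_int_def)
  have ne: "box (0,0) (2*pi,2*pi) \<noteq> ({} :: (real\<times>real) set)"
    by (simp add: box_ne_empty Basis_prod_def ball_Un)
  have "\<forall>z\<in>?box. f (fst z) (snd z) * f (fst z) (snd z) = 0"
    by (rule integral_cbox_eq_0_iff[THEN iffD1, OF continuous_on_subset[OF ff subset_UNIV] ne _ I0]) simp
  then have 0: "f s t = 0" if "s \<in> {0..2*pi}" "t \<in> {0..2*pi}" for s t
    using bspec[of ?box _ "(s,t)"] that by (simp add: cbox_Pair_eq)
  \<comment> \<open>Subtracting whole periods brings any point into the fundamental square.\<close>
  have bnd: "0 \<le> t + 2*pi * of_int (- \<lfloor>t / (2*pi)\<rfloor>) \<and> t + 2*pi * of_int (- \<lfloor>t / (2*pi)\<rfloor>) \<le> 2*pi" for t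
  proof -
    have "of_int \<lfloor>t / (2*pi)\<rfloor> \<le> t / (2*pi)" "t / (2*pi) < of_int \<lfloor>t / (2*pi)\<rfloor> + 1"
      using floor_correct[of "t / (2*pi)"] by auto
    then show ?thesis using pi_gt_zero
      by (simp add: pos_le_divide_eq pos_divide_less_eq algebra_simps del: of_int_floor_le)
  qed
  have "f x y = f (x + 2*pi * of_int (- \<lfloor>x / (2*pi)\<rfloor>)) (y + 2*pi * of_int (- \<lfloor>y / (2*pi)\<rfloor>))"
    by (rule periodic2_of_int[OF assms(2), symmetric])
  also have "\<dots> = 0" by (rule 0) (use bnd in \<open>simp_all only: atLeastAtMost_iff simp_thms\<close>)
  finally show ?thesis .
qed

lemma fcoeff_inject:
  assumes "smooth_periodic f" "smooth_periodic g" "\<And>m n. fcoeff f m n = fcoeff g m n"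
  shows "f = g"
proof (intro ext)
  fix x y
  have "smooth_periodic (\<lambda>x y. f x y - g x y)" by (intro smooth_periodic_diff assms)
  then have "f x y - g x y = 0"
    by (intro fcoeff_eq_0_imp_eq_0[of "\<lambda>x y. f x y - g x y"] smooth_periodic_cont2 smooth_periodic_periodic)
       (simp_all add: fcoeff_diff smooth_periodic_cont2 assms)
  then show "f x y = g x y" by simp
qed

text \<open>Symmetry of mixed partials read off the Fourier side: both orders multiply the mode
  \<open>(m, n)\<close> by \<open>- m * n\<close>.\<close>

lemma dy_dx_commute:
  assumes "smooth_periodic f" shows "dy (dx f) = dx (dy f)"
  using assms by (intro fcoeff_inject) (simp_all add: smooth_periodic_dx smooth_periodic_dy fcoeff_dx fcoeff_dy)

subsection \<open>The cosine series\<close>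

text \<open>The phase closes the family under differentiation: a derivative multiplies the
  coefficients by the frequency and advances the phase by \<open>pi/2\<close>.\<close>

definition trig :: "(nat \<Rightarrow> real) \<Rightarrow> real \<Rightarrow> real \<Rightarrow> real" where
  "trig c \<phi> t = (\<Sum>m. c (Suc m) * cos (real (Suc m) * t + \<phi>))"

lemma rapid_summable:
  assumes "rapid c" shows "summable (\<lambda>m. \<bar>c (Suc m)\<bar>)"
proof -
  obtain C where C: "\<And>m. m \<ge> 1 \<Longrightarrow> \<bar>c m\<bar> * real m ^ 2 \<le> C"
    using assms unfolding rapid_def by meson
  have "summable (\<lambda>m. C * inverse (real (Suc m) ^ 2))"
    using inverse_power_summable[of 2, where 'a = real] by (intro summable_mult) (subst summable_Suc_iff[of "\<lambda>m. inverse (real m ^ 2)"], simp)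
  then show ?thesis
  proof (rule summable_comparison_test'[where N = 0])
    show "norm \<bar>c (Suc m)\<bar> \<le> C * inverse (real (Suc m) ^ 2)" for m
      using C[of "Suc m"] by (simp add: field_simps)
  qed
qed

text \<open>The bound for exponent \<open>N\<close> comes from the bound on \<open>c\<close> for
  exponent \<open>Suc N\<close>.\<close>

lemma rapid_times: "rapid c \<Longrightarrow> rapid (\<lambda>m. real m * c m)"
  unfolding rapid_def
proof (intro allI)
  fix N assume "\<forall>N. \<exists>C. \<forall>m\<ge>1. \<bar>c m\<bar> * real m ^ N \<le> C"
  then obtain C where "\<forall>m\<ge>1. \<bar>c m\<bar> * real m ^ Suc N \<le> C" by blast
  then show "\<exists>C. \<forall>m\<ge>1. \<bar>real m * c m\<bar> * real m ^ N \<le> C"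
    by (intro exI[of _ C]) (simp add: abs_mult mult_ac)
qed

lemma trig_summable:
  assumes "rapid c" shows "summable (\<lambda>m. c (Suc m) * cos (real (Suc m) * t + \<phi>))"
  by (rule summable_comparison_test'[OF rapid_summable[OF assms], where N = 0])
     (simp add: abs_mult mult_left_le)

text \<open>Termwise differentiation, justified by the Weierstrass M-test for the series of
  derivatives.\<close>

lemma trig_derivative:
  assumes "rapid c"
  shows "(trig c \<phi> has_real_derivative trig (\<lambda>m. real m * c m) (\<phi> + pi/2) t) (at t)"
proof -
  let ?f' = "\<lambda>m t. (real (Suc m) * c (Suc m)) * cos (real (Suc m) * t + (\<phi> + pi/2))"
  have "uniformly_convergent_on UNIV (\<lambda>n t. \<Sum>m<n. ?f' m t)"
    by (rule Weierstrass_m_test'[OF _ rapid_summable[OF rapid_times[OF assms]]])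
       (simp add: abs_mult mult_left_le)
  moreover have "((\<lambda>t. c (Suc m) * cos (real (Suc m) * t + \<phi>)) has_real_derivative ?f' m t) (at t within UNIV)" for m t
    by (auto intro!: derivative_eq_intros simp: cos_add[of _ "pi/2"] add.assoc[symmetric])
  ultimately show ?thesis
    unfolding trig_def
    using has_field_derivative_series'(2)[of UNIV "\<lambda>m t. c (Suc m) * cos (real (Suc m) * t + \<phi>)" ?f' t t]
      trig_summable[OF assms] by simp
qed

lemma trig_periodic: "trig c \<phi> (t + 2*pi * of_int k) = trig c \<phi> t"
proof -
  have "cos (real (Suc m) * (t + 2*pi * of_int k) + \<phi>) = cos (real (Suc m) * t + \<phi>)" for m
  proof -
    have "real (Suc m) * (t + 2*pi * of_int k) + \<phi> = (real (Suc m) * t + \<phi>) + 2 * pi * of_int (int (Suc m) * k)"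
      by (simp add: algebra_simps)
    then show ?thesis using sin_cos_eq_iff by metis
  qed
  then show ?thesis by (simp only: trig_def)
qed

definition wave :: "int \<Rightarrow> int \<Rightarrow> (nat \<Rightarrow> real) \<Rightarrow> real \<Rightarrow> real \<Rightarrow> real \<Rightarrow> real" where
  "wave p q c \<phi> x y = trig c \<phi> (of_int p * x + of_int q * y)"

lemma has_partials_wave:
  assumes "rapid c"
  shows "has_partials (\<lambda>x y. k * wave p q c \<phi> x y)
     (\<lambda>x y. k * of_int p * wave p q (\<lambda>m. real m * c m) (\<phi> + pi/2) x y)
     (\<lambda>x y. k * of_int q * wave p q (\<lambda>m. real m * c m) (\<phi> + pi/2) x y)"
  unfolding has_partials_def wave_def
proof (intro allI conjI)
  fix x y
  let ?D = "trig (\<lambda>m. real m * c m) (\<phi> + pi/2) (of_int p * x + of_int q * y)"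
  have 1: "((\<lambda>t. of_int p * t + of_int q * y) has_real_derivative of_int p) (at x)"
    "((\<lambda>t. of_int p * x + of_int q * t) has_real_derivative of_int q) (at y)"
    by (auto intro!: derivative_eq_intros)
  show "((\<lambda>t. k * trig c \<phi> (of_int p * t + of_int q * y)) has_real_derivative k * of_int p * ?D) (at x)"
    using DERIV_cmult[OF DERIV_chain2[OF trig_derivative[OF assms] 1(1)], of k] by (simp add: mult_ac)
  show "((\<lambda>t. k * trig c \<phi> (of_int p * x + of_int q * t)) has_real_derivative k * of_int q * ?D) (at y)"
    using DERIV_cmult[OF DERIV_chain2[OF trig_derivative[OF assms] 1(2)], of k] by (simp add: mult_ac)
qed

text \<open>The factor \<open>k\<close> absorbs the integers \<open>p\<close> and \<open>q\<close>
  produced by the chain rule, so that scaled waves are stable under partials.\<close>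

lemma smooth_periodic_wave_scaled:
  assumes "rapid c" shows "smooth_periodic (\<lambda>x y. k * wave p q c \<phi> x y)"
proof (rule smooth_periodic_coinduct[of "\<lambda>f. \<exists>k c \<phi>. rapid c \<and> f = (\<lambda>x y. k * wave p q c \<phi> x y)"])
  fix f assume "\<exists>k c \<phi>. rapid c \<and> f = (\<lambda>x y. k * wave p q c \<phi> x y)"
  then obtain k c \<phi> where c: "rapid c" and f: "f = (\<lambda>x y. k * wave p q c \<phi> x y)" by blast
  have "isCont (trig c \<phi>) t" for t
    using trig_derivative[OF c] DERIV_isCont by blast
  then have ct: "continuous_on UNIV (trig c \<phi>)"
    using continuous_at_imp_continuous_on by blast
  have "cont2 f"
    unfolding f wave_def
    by (intro continuous_on_mult continuous_on_const continuous_on_compose2[OF ct] continuous_intros) auto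
  moreover have "periodic2 f"
    unfolding periodic2_def f wave_def
    using trig_periodic[of c \<phi> "of_int p * x + of_int q * y" p for x y]
      trig_periodic[of c \<phi> "of_int p * x + of_int q * y" q for x y]
    by (simp add: algebra_simps)
  ultimately show "periodic2 f \<and> cont2 f \<and>
     (\<exists>g h. (\<exists>k c \<phi>. rapid c \<and> g = (\<lambda>x y. k * wave p q c \<phi> x y)) \<and>
            (\<exists>k c \<phi>. rapid c \<and> h = (\<lambda>x y. k * wave p q c \<phi> x y)) \<and> has_partials f g h)"
    using has_partials_wave[OF c, of k p q \<phi>] rapid_times[OF c] unfolding f by blast
qed (use assms in blast)

lemma smooth_periodic_wave: "rapid c \<Longrightarrow> smooth_periodic (wave p q c \<phi>)"
  using smooth_periodic_wave_scaled[of c 1 p q \<phi>] by simp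

lemma Lop_wave:
  assumes "rapid c" shows "Lop (wave p q c \<phi>) = (\<lambda>x y. of_int (p * q * (p\<^sup>2 - q\<^sup>2)) *
    wave p q (\<lambda>m. real m * (real m * (real m * (real m * c m)))) (\<phi> + pi/2 + pi/2 + pi/2 + pi/2) x y)"
proof -
  have d: "dx (\<lambda>x y. k * wave p q c \<phi> x y) = (\<lambda>x y. k * of_int p * wave p q (\<lambda>m. real m * c m) (\<phi> + pi/2) x y)"
    "dy (\<lambda>x y. k * wave p q c \<phi> x y) = (\<lambda>x y. k * of_int q * wave p q (\<lambda>m. real m * c m) (\<phi> + pi/2) x y)"
    if "rapid c" for k c \<phi>
    using has_partials_wave[OF that] by (blast intro: has_partials_dx has_partials_dy)+
  \<comment> \<open>The factor 1 brings the wave into the scaled form to which the rules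
    \<open>d\<close> apply repeatedly.\<close>
  have "Lop (\<lambda>x y. 1 * wave p q c \<phi> x y) = (\<lambda>x y. of_int (p * q * (p\<^sup>2 - q\<^sup>2)) *
    wave p q (\<lambda>m. real m * (real m * (real m * (real m * c m)))) (\<phi> + pi/2 + pi/2 + pi/2 + pi/2) x y)"
    unfolding Lop_def
    by (simp only: pd.simps if_True if_False d rapid_times assms)
       (simp add: algebra_simps power2_eq_square)
  then show ?thesis by simp
qed

lemma cos_series_waves:
  assumes "rapid a" "rapid b"
  shows "cos_series a b = (\<lambda>x y. (wave 1 0 a 0 x y + wave 0 1 a 0 x y) + (wave 1 (-1) b 0 x y + wave 1 1 b 0 x y))"
proof (intro ext)
  fix x y
  have "(\<Sum>m. c (Suc m) * cos (real (Suc m) * s)) + (\<Sum>m. c (Suc m) * cos (real (Suc m) * t)) =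
      (\<Sum>m. c (Suc m) * (cos (real (Suc m) * s) + cos (real (Suc m) * t)))" if "rapid c" for c s t
    using suminf_add[OF trig_summable[OF that, of s 0] trig_summable[OF that, of t 0]]
    by (simp only: distrib_left add_0_right)
  then show "cos_series a b x y = (wave 1 0 a 0 x y + wave 0 1 a 0 x y) + (wave 1 (-1) b 0 x y + wave 1 1 b 0 x y)"
    using assms by (simp add: cos_series_def wave_def trig_def del: of_nat_Suc)
qed

lemma smooth_periodic_cos_series: "rapid a \<Longrightarrow> rapid b \<Longrightarrow> smooth_periodic (cos_series a b)"
  by (simp add: cos_series_waves smooth_periodic_add smooth_periodic_wave)

text \<open>Invariance under reflections that generate the dihedral group of the square.\<close>

definition d4_sym :: "(real \<Rightarrow> real \<Rightarrow> real) \<Rightarrow> bool" where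
  "d4_sym f \<longleftrightarrow> (\<forall>x y. f (- x) y = f x y \<and> f x (- y) = f x y \<and> f y x = f x y)"

lemma d4_sym_cos_series: "d4_sym (cos_series a b)"
proof -
  have "cos (r * (- x - y)) = cos (r * (x + y))" "cos (r * (- x + y)) = cos (r * (x - y))"
     "cos (r * (y - x)) = cos (r * (x - y))" for r x y :: real
    using cos_minus[of "r * (x + y)"] cos_minus[of "r * (x - y)"] by (simp_all add: algebra_simps)
  then show ?thesis
    unfolding d4_sym_def cos_series_def by (simp add: add.commute del: of_nat_Suc)
qed

subsection \<open>The linear operator\<close>

lemma fcoeff_Lop:
  assumes "smooth_periodic u"
  shows "fcoeff (Lop u) m n = of_int (m * n * (m\<^sup>2 - n\<^sup>2)) * fcoeff u m n"
proof -
  have "fcoeff (Lop u) m n = fcoeff (pd [True,True,True,False] u) m n - fcoeff (pd [True,False,False,False] u) m n"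
    unfolding Lop_def using assms by (intro fcoeff_diff smooth_periodic_cont2 smooth_periodic_pd)
  also have "\<dots> = of_int (m * n * (m\<^sup>2 - n\<^sup>2)) * fcoeff u m n"
    using assms by (simp add: fcoeff_dx fcoeff_dy smooth_periodic_dx smooth_periodic_dy power2_eq_square algebra_simps)
  finally show ?thesis .
qed

lemma smooth_periodic_Lop: "smooth_periodic u \<Longrightarrow> smooth_periodic (Lop u)"
  unfolding Lop_def by (intro smooth_periodic_diff smooth_periodic_pd)

text \<open>The four wave directions are zeros of the symbol, so \<open>Lop\<close> annihilates each
  wave. Reading this on the Fourier side avoids computing any coefficient of the series.\<close>

lemma fcoeff_cos_series:
  assumes "rapid a" "rapid b"
  shows "of_int (m * n * (m\<^sup>2 - n\<^sup>2)) * fcoeff (cos_series a b) m n = 0"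
proof -
  have w: "of_int (m * n * (m\<^sup>2 - n\<^sup>2)) * fcoeff (wave p q c 0) m n = 0"
    if "rapid c" "p * q * (p\<^sup>2 - q\<^sup>2) = 0" for p q c
  proof -
    have "Lop (wave p q c 0) = (\<lambda>x y. 0)" unfolding Lop_wave[OF that(1)] that(2) by simp
    then show ?thesis using fcoeff_Lop[OF smooth_periodic_wave[OF that(1)], of p q 0 m n]
      by (simp add: fcoeff_torus_int torus_int_def)
  qed
  have "fcoeff (cos_series a b) m n = (fcoeff (wave 1 0 a 0) m n + fcoeff (wave 0 1 a 0) m n)
      + (fcoeff (wave 1 (-1) b 0) m n + fcoeff (wave 1 1 b 0) m n)"
  proof -
    have "smooth_periodic (\<lambda>x y. wave 1 0 a 0 x y + wave 0 1 a 0 x y)" "smooth_periodic (\<lambda>x y. wave 1 (-1) b 0 x y + wave 1 1 b 0 x y)"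
      using assms by (simp_all add: smooth_periodic_add smooth_periodic_wave)
    from fcoeff_add[OF this[THEN smooth_periodic_cont2]] show ?thesis
      by (simp only: cos_series_waves[OF assms] fcoeff_add[OF smooth_periodic_cont2 smooth_periodic_cont2, OF smooth_periodic_wave smooth_periodic_wave] assms)
  qed
  then show ?thesis
    using w[OF assms(1), of 1 0] w[OF assms(1), of 0 1] w[OF assms(2), of 1 "-1"] w[OF assms(2), of 1 1]
    by (auto simp: distrib_left)
qed

definition sol :: "(real \<Rightarrow> real \<Rightarrow> real) \<Rightarrow> real \<Rightarrow> real \<Rightarrow> real" where
  "sol f = line_op 1 0 (line_op 0 1 (line_op 1 1 (line_op 1 (-1) f)))"

lemma smooth_periodic_sol: "smooth_periodic f \<Longrightarrow> smooth_periodic (sol f)"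
  unfolding sol_def by (intro smooth_periodic_line_op)

lemma fcoeff_sol:
  assumes "smooth_periodic f"
  shows "fcoeff (sol f) m n = kappa m * kappa n * kappa (m + n) * kappa (m - n) * fcoeff f m n"
  using assms unfolding sol_def
  by (simp add: fcoeff_line_op smooth_periodic_cont2 smooth_periodic_periodic smooth_periodic_line_op)

lemma resonant_iff: "resonant m n \<longleftrightarrow> m = 0 \<or> n = 0 \<or> m + n = 0 \<or> m - n = 0"
proof -
  have "m * n * (m\<^sup>2 - n\<^sup>2) = m * n * ((m + n) * (m - n))"
    by (simp add: power2_eq_square algebra_simps)
  then show ?thesis by (auto simp: resonant_def)
qed

lemma fcoeff_sol_resonant:
  assumes "smooth_periodic f" "resonant m n" shows "fcoeff (sol f) m n = 0"
  using assms by (auto simp: fcoeff_sol resonant_iff kappa_0)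

text \<open>At resonant modes both sides vanish. Elsewhere the four factors \<open>1 / \<i>\<close>
  multiply to 1, and the product of the \<open>kappa\<close> values is the reciprocal of the symbol
  \<open>m * n * (m + n) * (m - n)\<close>.\<close>

lemma Lop_sol:
  assumes "smooth_periodic f" "\<And>m n. resonant m n \<Longrightarrow> fcoeff f m n = 0"
  shows "Lop (sol f) = f"
proof (rule fcoeff_inject[OF smooth_periodic_Lop[OF smooth_periodic_sol] assms(1)])
  fix m n
  show "fcoeff (Lop (sol f)) m n = fcoeff f m n"
  proof (cases "resonant m n")
    case True
    then show ?thesis using assms by (simp add: fcoeff_Lop smooth_periodic_sol fcoeff_sol_resonant)
  next
    case False
    then have nz: "m \<noteq> 0" "n \<noteq> 0" "m + n \<noteq> 0" "m - n \<noteq> 0" by (auto simp: resonant_iff)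
    have "kappa m * kappa n * kappa (m + n) * kappa (m - n) = 1 / (of_int (m * n * ((m + n) * (m - n))))"
      unfolding nz[THEN kappa_nz] by (simp add: mult_ac)
    moreover have "m * n * ((m + n) * (m - n)) = m * n * (m\<^sup>2 - n\<^sup>2)"
      by (simp add: power2_eq_square algebra_simps)
    moreover have "m * n * (m\<^sup>2 - n\<^sup>2) \<noteq> 0" using False by (simp add: resonant_def)
    then have "complex_of_int (m * n * (m\<^sup>2 - n\<^sup>2)) \<noteq> 0" by (simp only: of_int_eq_0_iff not_False_eq_True)
    ultimately show ?thesis
      by (simp add: fcoeff_Lop smooth_periodic_sol fcoeff_sol assms(1) del: of_int_mult of_int_diff of_int_power)
  qed
qed (fact assms(1))

lemma Lop_unique:
  assumes "smooth_periodic u" "smooth_periodic v" "Lop u = Lop v"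
    "\<And>m n. resonant m n \<Longrightarrow> fcoeff u m n = fcoeff v m n"
  shows "u = v"
proof (rule fcoeff_inject[OF assms(1,2)])
  fix m n
  have "of_int (m * n * (m\<^sup>2 - n\<^sup>2)) * fcoeff u m n = of_int (m * n * (m\<^sup>2 - n\<^sup>2)) * fcoeff v m n"
    using fcoeff_Lop assms by metis
  moreover have "complex_of_int (m * n * (m\<^sup>2 - n\<^sup>2)) = 0 \<longleftrightarrow> resonant m n"
    by (simp only: resonant_def of_int_eq_0_iff)
  ultimately show "fcoeff u m n = fcoeff v m n"
    using assms(4) by (metis mult_left_cancel)
qed

subsection \<open>Symmetries\<close>

text \<open>Under the dihedral group of the square such a function transforms by the determinant,
  which is -1 on each of these reflections.\<close>

definition d4_anti :: "(real \<Rightarrow> real \<Rightarrow> real) \<Rightarrow> bool" where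
  "d4_anti f \<longleftrightarrow> (\<forall>x y. f (- x) y = - f x y \<and> f x (- y) = - f x y \<and> f y x = - f x y)"

lemma fcoeff_d4_anti:
  assumes "smooth_periodic f" "d4_anti f"
  shows "fcoeff f (- m) n = - fcoeff f m n" "fcoeff f n m = - fcoeff f m n"
proof -
  have eq: "f (- x) y = - f x y" "f y x = - f x y" for x y
    using assms(2) unfolding d4_anti_def by blast+
  have "(\<lambda>x y. f (- x) y) = (\<lambda>x y. - f x y)" by (intro ext eq(1))
  then show "fcoeff f (- m) n = - fcoeff f m n"
    using fcoeff_flip[of f m n] assms(1) by (simp add: fcoeff_uminus smooth_periodic_cont2 smooth_periodic_periodic)
  have "(\<lambda>x y. f y x) = (\<lambda>x y. - f x y)" by (intro ext eq(2))
  then show "fcoeff f n m = - fcoeff f m n"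
    using fcoeff_swap[of f m n] assms(1) by (simp only: fcoeff_uminus smooth_periodic_cont2)
qed

lemma fcoeff_d4_anti_resonant:
  assumes "smooth_periodic f" "d4_anti f" "resonant m n"
  shows "fcoeff f m n = 0"
proof -
  \<comment> \<open>These coefficients equal their own negatives; the other two resonant families
    are images of them under the same symmetries.\<close>
  have 0: "fcoeff f 0 k = 0" "fcoeff f k k = 0" for k
    using fcoeff_d4_anti(1)[OF assms(1,2), of 0 k] fcoeff_d4_anti(2)[OF assms(1,2), of k k] by simp_all
  then have "fcoeff f k 0 = 0" "fcoeff f (- k) k = 0" for k
    using fcoeff_d4_anti(2)[OF assms(1,2), of k 0] fcoeff_d4_anti(1)[OF assms(1,2), of k k] by simp_all
  moreover have "m = 0 \<or> n = 0 \<or> m = - n \<or> m = n" using assms(3) by (auto simp: resonant_iff)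
  ultimately show ?thesis using 0 by auto
qed

lemma kappa_minus: "kappa (- j) = - kappa j"
  by (cases "j = 0") (simp_all add: kappa_0 kappa_nz)

text \<open>The multiplier \<open>kappa m * kappa n * kappa (m + n) * kappa (m - n)\<close> changes
  sign under \<open>m\<close> to \<open>- m\<close> and under exchanging \<open>m\<close> and
  \<open>n\<close>, because \<open>kappa\<close> is odd. These signs cancel those of
  \<open>f\<close>.\<close>

lemma d4_sym_sol:
  assumes "smooth_periodic f" "d4_anti f"
  shows "d4_sym (sol f)"
proof -
  have sp: "smooth_periodic (sol f)" by (rule smooth_periodic_sol[OF assms(1)])
  have 1: "(\<lambda>x y. sol f (- x) y) = sol f"
  proof (rule fcoeff_inject[OF smooth_periodic_flip[OF sp] sp])
    fix m n
    have "kappa (- m + n) = - kappa (m - n)" "kappa (- m - n) = - kappa (m + n)"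
      using kappa_minus[of "m - n"] kappa_minus[of "m + n"] by simp_all
    then show "fcoeff (\<lambda>x y. sol f (- x) y) m n = fcoeff (sol f) m n"
      using sp by (simp add: fcoeff_flip smooth_periodic_cont2 smooth_periodic_periodic fcoeff_sol assms(1)
         fcoeff_d4_anti(1)[OF assms] kappa_minus[of m])
  qed
  have 2: "(\<lambda>x y. sol f y x) = sol f"
  proof (rule fcoeff_inject[OF smooth_periodic_swap[OF sp] sp])
    fix m n
    have "kappa (n - m) = - kappa (m - n)" "kappa (n + m) = kappa (m + n)"
      using kappa_minus[of "m - n"] by (simp_all add: add.commute)
    then show "fcoeff (\<lambda>x y. sol f y x) m n = fcoeff (sol f) m n"
      using sp by (simp add: fcoeff_swap smooth_periodic_cont2 fcoeff_sol assms(1)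
         fcoeff_d4_anti(2)[OF assms, of n m])
  qed
  \<comment> \<open>Reflection in \<open>y\<close> is reflection in \<open>x\<close> conjugated by
    the swap.\<close>
  show ?thesis
    unfolding d4_sym_def using fun_cong[OF fun_cong[OF 1]] fun_cong[OF fun_cong[OF 2]] by metis
qed

text \<open>By the chain rule every \<open>x\<close>-derivative contributes one sign, and
  \<open>y\<close>-derivatives contribute none.\<close>

lemma pd_flip:
  assumes "smooth_periodic f" "d4_sym f"
  shows "pd ws f (- x) y = (-1) ^ count_list ws True * pd ws f x y"
proof (induction ws arbitrary: x y)
  case Nil
  then show ?case using assms(2) by (simp add: d4_sym_def)
next
  case (Cons w ws)
  let ?s = "(-1) ^ count_list ws True :: real"
  have p: "((\<lambda>t. pd ws f t y) has_real_derivative dx (pd ws f) x y) (at x)"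
    "((\<lambda>t. pd ws f x t) has_real_derivative dy (pd ws f) x y) (at y)" for x y
    using smooth_periodic_has_partials[OF smooth_periodic_pd[OF assms(1)]] by (auto simp: has_partials_def)
  have "((\<lambda>t. pd ws f (- t) y) has_real_derivative - dx (pd ws f) (- x) y) (at x)"
    using p(1)[of y "- x"] by (simp add: DERIV_mirror)
  moreover have "((\<lambda>t. pd ws f (- t) y) has_real_derivative ?s * dx (pd ws f) x y) (at x)"
    unfolding Cons by (rule DERIV_cmult[OF p(1)])
  ultimately have 1: "dx (pd ws f) (- x) y = - ?s * dx (pd ws f) x y"
    using DERIV_unique by fastforce
  have "((\<lambda>t. pd ws f (- x) t) has_real_derivative ?s * dy (pd ws f) x y) (at y)"
    unfolding Cons by (rule DERIV_cmult[OF p(2)])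
  with p(2)[of "- x" y] have 2: "dy (pd ws f) (- x) y = ?s * dy (pd ws f) x y"
    by (rule DERIV_unique)
  show ?case using 1 2 by simp
qed

lemma pd_swap:
  assumes "d4_sym f"
  shows "pd ws f y x = pd (map Not ws) f x y"
proof (induction ws arbitrary: x y)
  case Nil
  then show ?case using assms by (simp add: d4_sym_def)
next
  case (Cons w ws)
  then show ?case by (simp add: dx_def dy_def)
qed

lemma pd_flip_snd:
  assumes "smooth_periodic f" "d4_sym f"
  shows "pd ws f x (- y) = (-1) ^ count_list (map Not ws) True * pd ws f x y"
proof -
  have "pd ws f x (- y) = pd (map Not ws) f (- y) x" by (rule pd_swap[OF assms(2)])
  also have "\<dots> = (-1) ^ count_list (map Not ws) True * pd (map Not ws) f y x" by (rule pd_flip[OF assms])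
  also have "pd (map Not ws) f y x = pd ws f x y" using pd_swap[OF assms(2), of ws x y] by simp
  finally show ?thesis .
qed

text \<open>Every product in \<open>Qop\<close> carries an odd total number of
  \<open>x\<close>-derivatives and an odd total number of \<open>y\<close>-derivatives, which gives
  both reflections. The swap exchanges the two terms of each difference.\<close>

lemma d4_anti_Qop:
  assumes "smooth_periodic u" "d4_sym u" "smooth_periodic v" "d4_sym v"
  shows "d4_anti (Qop u v)"
  unfolding d4_anti_def
proof (intro allI conjI)
  fix x y
  show "Qop u v (- x) y = - Qop u v x y"
    unfolding Qop_def pd_flip[OF assms(1,2)] pd_flip[OF assms(3,4)] by simp
  show "Qop u v x (- y) = - Qop u v x y"
    unfolding Qop_def pd_flip_snd[OF assms(1,2)] pd_flip_snd[OF assms(3,4)] by simp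
  \<comment> \<open>The swap also reverses the roles of the letters within a word, so mixed partials
    are reordered to a common form before the terms can cancel.\<close>
  have m: "pd [False, True] u = pd [True, False] u" "pd [False, True, True] v = pd [True, True, False] v"
    "pd [True, False, False] v = pd [False, False, True] v"
    "pd [False, True, True, True] v = pd [True, True, True, False] v"
    "pd [True, False, False, False] v = pd [False, False, False, True] v"
    using assms(1,3) by (simp_all add: dy_dx_commute smooth_periodic_dx smooth_periodic_dy)
  show "Qop u v y x = - Qop u v x y"
    unfolding Qop_def pd_swap[OF assms(2), of _ y x] pd_swap[OF assms(4), of _ y x] list.map not_True_eq_False not_False_eq_True m
    by (simp only: algebra_simps)
qed

lemma smooth_periodic_Qop:
  "smooth_periodic u \<Longrightarrow> smooth_periodic v \<Longrightarrow> smooth_periodic (Qop u v)"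
  unfolding Qop_def
  by (intro smooth_periodic_add smooth_periodic_mult smooth_periodic_diff smooth_periodic_const smooth_periodic_pd)

lemma smooth_periodic_rhs:
  "(\<And>p. p < k \<Longrightarrow> smooth_periodic (lam p)) \<Longrightarrow> smooth_periodic (rhs lam k)"
  unfolding rhs_def by (intro smooth_periodic_sum smooth_periodic_Qop) auto

lemma d4_anti_rhs:
  assumes "\<And>p. p < k \<Longrightarrow> smooth_periodic (lam p) \<and> d4_sym (lam p)"
  shows "d4_anti (rhs lam k)"
proof -
  have "d4_anti (Qop (lam p) (lam (k - 1 - p)))" if "p < k" for p
    \<comment> \<open>For \<open>p < k\<close> the index \<open>k - 1 - p\<close> is again below
      \<open>k\<close>; for \<open>k = 0\<close> the sum is empty and the truncated subtraction is
      harmless.\<close>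
    using that assms[of p] assms[of "k - 1 - p"] by (intro d4_anti_Qop) auto
  then have Q: "Qop (lam p) (lam (k - 1 - p)) (- x) y = - Qop (lam p) (lam (k - 1 - p)) x y"
    "Qop (lam p) (lam (k - 1 - p)) x (- y) = - Qop (lam p) (lam (k - 1 - p)) x y"
    "Qop (lam p) (lam (k - 1 - p)) y x = - Qop (lam p) (lam (k - 1 - p)) x y" if "p < k" for p x y
    using that unfolding d4_anti_def by blast+
  show ?thesis
    unfolding d4_anti_def rhs_def sum_negf[symmetric]
    by (intro allI conjI sum.cong refl Q) auto
qed

subsection \<open>The recursion\<close>

text \<open>The right-hand side is spelled out instead of using \<open>rhs (lam_seq h)\<close>, so
  that the recursive calls appear at explicit indices below \<open>k\<close> and termination can be
  checked.\<close>

function lam_seq :: "(nat \<Rightarrow> real \<Rightarrow> real \<Rightarrow> real) \<Rightarrow> nat \<Rightarrow> real \<Rightarrow> real \<Rightarrow> real" where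
  "lam_seq h k = (\<lambda>x y. sol (\<lambda>x y. \<Sum>p<k. Qop (lam_seq h p) (lam_seq h (k - 1 - p)) x y) x y + h k x y)"
  by pat_completeness auto
termination by (relation "Wellfounded.measure snd") auto

text \<open>The equation matches its own recursive calls and would be unfolded forever by the
  simplifier.\<close>

declare lam_seq.simps [simp del]

lemma lam_seq_eq: "lam_seq h k = (\<lambda>x y. sol (rhs (lam_seq h) k) x y + h k x y)"
  by (subst lam_seq.simps) (simp only: rhs_def)

text \<open>Symmetric earlier terms produce an antisymmetric right-hand side, which
  \<open>sol\<close> turns back into a symmetric function; this keeps the recursion going.\<close>

lemma lam_seq_smooth_sym:
  assumes "\<And>k. smooth_periodic (h k)" "\<And>k. d4_sym (h k)"
  shows "smooth_periodic (lam_seq h k) \<and> d4_sym (lam_seq h k)"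
proof (induction k rule: less_induct)
  case (less k)
  have sp: "smooth_periodic (rhs (lam_seq h) k)" using less by (intro smooth_periodic_rhs) blast
  have "d4_sym (sol (rhs (lam_seq h) k))" using d4_sym_sol[OF sp d4_anti_rhs] less by blast
  then have "d4_sym (\<lambda>x y. sol (rhs (lam_seq h) k) x y + h k x y)"
    using assms(2)[of k] unfolding d4_sym_def by metis
  then show ?case
    using smooth_periodic_add[OF smooth_periodic_sol[OF sp] assms(1)] by (simp only: lam_seq_eq[of h k] simp_thms)
qed

theorem theorem7:
  fixes a b :: "nat \<Rightarrow> real" and A B :: "nat \<Rightarrow> nat \<Rightarrow> real"
  assumes "rapid a" and "rapid b" and "\<forall>k\<ge>1. rapid (A k) \<and> rapid (B k)"
  shows "\<exists>lam :: nat \<Rightarrow> real \<Rightarrow> real \<Rightarrow> real.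
     lam 0 = cos_series a b \<and>
     (\<forall>k\<ge>1.
        smooth_periodic (rhs lam k) \<and>
        (\<forall>m::int. fcoeff (rhs lam k) m 0 = 0 \<and> fcoeff (rhs lam k) 0 m = 0 \<and>
                  fcoeff (rhs lam k) m m = 0 \<and> fcoeff (rhs lam k) m (- m) = 0) \<and>
        smooth_periodic (lam k) \<and>
        Lop (lam k) = rhs lam k \<and>
        smooth_periodic (\<lambda>x y. lam k x y - cos_series (A k) (B k) x y) \<and>
        Lop (\<lambda>x y. lam k x y - cos_series (A k) (B k) x y) = rhs lam k \<and>
        (\<forall>m n. resonant m n \<longrightarrow> fcoeff (\<lambda>x y. lam k x y - cos_series (A k) (B k) x y) m n = 0) \<and>
        (\<forall>mu. smooth_periodic mu \<and> Lop mu = rhs lam k \<and>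
              (\<forall>m n. resonant m n \<longrightarrow> fcoeff mu m n = 0) \<longrightarrow>
              mu = (\<lambda>x y. lam k x y - cos_series (A k) (B k) x y))) \<and>
     (\<forall>k x y. lam k (- x) y = lam k x y \<and> lam k x (- y) = lam k x y \<and> lam k y x = lam k x y)"
proof -
  \<comment> \<open>The initial term is treated as the prescribed part at \<open>k = 0\<close>, so
    that one recursion covers all indices.\<close>
  define h where "h k = (if k = 0 then cos_series a b else cos_series (A k) (B k))" for k
  define lam where "lam = lam_seq h"
  have h: "smooth_periodic (h k)" "d4_sym (h k)" for k
    using assms by (auto simp: h_def smooth_periodic_cos_series d4_sym_cos_series)
  have lam: "smooth_periodic (lam k)" "d4_sym (lam k)" for k
    using lam_seq_smooth_sym[of h, OF h] by (auto simp: lam_def)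
  have R: "smooth_periodic (rhs lam k)" for k by (intro smooth_periodic_rhs lam)
  have R0: "fcoeff (rhs lam k) m n = 0" if "resonant m n" for k m n
    using fcoeff_d4_anti_resonant[OF R d4_anti_rhs that] lam by blast
  have LS: "Lop (sol (rhs lam k)) = rhs lam k" for k by (rule Lop_sol[OF R R0])
  have eq: "lam k = (\<lambda>x y. sol (rhs lam k) x y + h k x y)" for k
    unfolding lam_def by (rule lam_seq_eq)
  have diff: "(\<lambda>x y. lam k x y - cos_series (A k) (B k) x y) = sol (rhs lam k)" if "k \<ge> 1" for k
    using that by (subst eq) (simp add: h_def)
  have "lam 0 = cos_series a b"
  proof -
    \<comment> \<open>The empty sum gives zero, and \<open>sol\<close> of zero is zero, so only
      \<open>h 0\<close> remains.\<close>
    have "rhs lam 0 = (\<lambda>x y. 0)" by (simp add: rhs_def)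
    then show ?thesis by (subst eq) (simp add: h_def sol_def line_op_def)
  qed
  moreover have "Lop (lam k) = rhs lam k" if "k \<ge> 1" for k
  proof (rule fcoeff_inject[OF smooth_periodic_Lop[OF lam(1)] R])
    fix m n
    let ?c = "of_int (m * n * (m\<^sup>2 - n\<^sup>2)) :: complex"
    \<comment> \<open>The prescribed part lives on resonant modes, where the symbol vanishes, so
      adding it does not disturb the equation solved by \<open>sol\<close>.\<close>
    have h0: "?c * fcoeff (h k) m n = 0"
      using that fcoeff_cos_series[of "A k" "B k" m n] assms(3) by (simp add: h_def)
    have "fcoeff (Lop (lam k)) m n = ?c * fcoeff (lam k) m n" by (rule fcoeff_Lop[OF lam(1)])
    also have "fcoeff (lam k) m n = fcoeff (sol (rhs lam k)) m n + fcoeff (h k) m n"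
      by (subst eq) (intro fcoeff_add smooth_periodic_cont2 smooth_periodic_sol R h)
    also have "?c * \<dots> = ?c * fcoeff (sol (rhs lam k)) m n"
      using h0 by (simp only: distrib_left add_0_right)
    also have "\<dots> = fcoeff (Lop (sol (rhs lam k))) m n"
      by (rule fcoeff_Lop[OF smooth_periodic_sol[OF R], symmetric])
    finally show "fcoeff (Lop (lam k)) m n = fcoeff (rhs lam k) m n" by (simp only: LS)
  qed
  moreover have "mu = sol (rhs lam k)"
    if "smooth_periodic mu" "Lop mu = rhs lam k" "\<forall>m n. resonant m n \<longrightarrow> fcoeff mu m n = 0" for mu k
    by (rule Lop_unique[OF that(1) smooth_periodic_sol[OF R]])
       (simp_all add: that LS fcoeff_sol_resonant R)
  moreover have "lam k (- x) y = lam k x y \<and> lam k x (- y) = lam k x y \<and> lam k y x = lam k x y" for k x y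
    using lam(2)[of k] unfolding d4_sym_def by blast
  moreover have "resonant m 0" "resonant 0 m" "resonant m m" "resonant m (- m)" for m
    by (simp_all add: resonant_def)
  ultimately show ?thesis
    by (intro exI[of _ lam] conjI allI impI)
       (simp_all add: diff R R0 lam(1) LS fcoeff_sol_resonant smooth_periodic_sol)
qed

end
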